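(* Let $c\ge 1$ and let $I=\langle\mathrm{Inc}(\mathbb{N})\cdot x^{\underline{a}}\rangle\subset K[X]=K[x_{i,j}\mid 1\le i\le c,\ j\ge 1]$ be the ideal generated by the orbit of a monomial $x^{\underline{a}}=\prod_{i=1}^{c}\prod_{j=1}^{\mu_r}x_{i,j}^{a_{i,j}}$ of positive degree, where $\underline{a}\in\mathbb{N}_0^{c\times\mu_r}$ is a matrix whose non-zero columns are exactly those with indices $\mu_1<\mu_2<\dots<\mu_r$. Put $b_j=\sum_{i=1}^{c}a_{i,\mu_j}$ for $j=1,\dots,r$, $\underline{b}=(b_1,\dots,b_r)$ and $\underline{\mu}=(\mu_1,\dots,\mu_r)$. Then the equivariant Hilbert series of $A=K[X]/I$ is \[ H_A(s,t)=\frac{g_{r,c,\underline{b},\underline{\mu}}(s,t)}{(1-t)^{c(\mu_r-r-1)+r}\prod_{j=1}^{r}\bigl[(1-t)^{c-1}-s(1+t+\cdots+t^{b_j-1})\bigr]}, \] where $g_{r,c,\underline{b},\underline{\mu}}(s,t)\in\mathbb{Z}[s,t]$ is the polynomial with \[ g_{r,c,\underline{b},\underline{\mu}}(s,t)\cdot\bigl[(1-t)^c-s\bigr]=(1-t)^{c(\mu_r-r)}\prod_{j=1}^{r}\bigl[(1-t)^c-s+st^{b_j}\bigr]-s^{\mu_r}t^{\sum_{j=1}^{r}b_j}. \] Furthermore, the rational function \[ \frac{g_{r,c,\underline{b},\underline{\mu}}(s,t)}{(1-t)^{c(\mu_r-r-1)+r}\prod_{j=1}^{r}\bigl[(1-t)^{c-1}-s(1+t+\cdots+t^{b_j-1})\bigr]}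 \] is in reduced form, that is, the given numerator and denominator polynomials are relatively prime (where, if the exponent $c(\mu_r-r-1)+r$ is negative, the corresponding power of $1-t$ is regarded as a factor of the numerator). The exponent $c(\mu_r-r-1)+r$ of $(1-t)$ is negative if and only if $r<c$ and $\mu_r=r$.
   Context: $K$ is a field, $\mathbb{N}$ is the set of positive integers, $\mathbb{N}_0$ the set of non-negative integers, and $K[X]=K[x_{i,j}\mid 1\le i\le c,\ j\ge 1]$ is a standard graded polynomial ring. $\mathrm{Inc}(\mathbb{N})=\{\pi:\mathbb{N}\to\mathbb{N}\mid\pi(i)<\pi(i+1)\text{ for all }i\ge 1\}$ is the monoid of strictly increasing functions; it acts on $K[X]$ by $K$-algebra endomorphisms with $\pi\cdot x_{i,j}=x_{i,\pi(j)}$. For a monomial $m$, $\langle\mathrm{Inc}(\mathbb{N})\cdot m\rangle$ is the ideal of $K[X]$ generated by the orbit $\{\pi\cdot m\mid\pi\in\mathrm{Inc}(\mathbb{N})\}$. For $n\in\mathbb{N}_0$ put $K[X_n]=K[x_{i,j}\mid 1\le i\le c,\ 1\le j\le n]$ (so $K[X_0]=K$) and $I_n=I\cap K[X_n]$. The equivariant Hilbert series of $A=K[X]/I$ is the formal power series $H_A(s,t)=\sum_{n\ge 0,\,j\ge 0}\dim_K[K[X_n]/I_n]_j\,s^nt^j$, where $[\,\cdot\,]_j$ denotes the degree $j$ component. *)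

theory Defs
  imports
    "HOL-Library.Poly_Mapping"
    "HOL-Computational_Algebra.Polynomial_Factorial"
    "HOL-Computational_Algebra.Polynomial_FPS"
    "HOL-Algebra.QuotRing"
    "HOL-Algebra.Embedded_Algebras"
begin

text \<open>
  A monomial is a finitely supported exponent vector; the index \<open>(i, j)\<close> stands for \<open>x\<^sub>i\<^sub>,\<^sub>j\<close>.
  The type contains variables for all pairs of natural numbers, so the polynomial rings in question
  are carved out as the carriers of ring records below.
\<close>

type_synonym pmonom = "(nat \<times> nat) \<Rightarrow>\<^sub>0 nat"
type_synonym 'k mpoly = "pmonom \<Rightarrow>\<^sub>0 'k"

definition pmonom_deg :: "pmonom \<Rightarrow> nat" where
  "pmonom_deg m = (\<Sum>v\<in>Poly_Mapping.keys m. Poly_Mapping.lookup m v)"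

definition pconst :: "'k::comm_ring_1 \<Rightarrow> 'k mpoly" where
  "pconst k = Poly_Mapping.single 0 k"

definition pvar :: "nat \<Rightarrow> nat \<Rightarrow> 'k::comm_ring_1 mpoly" where
  "pvar i j = Poly_Mapping.single (Poly_Mapping.single (i, j) 1) 1"

definition homogeneous :: "nat \<Rightarrow> 'k::comm_ring_1 mpoly \<Rightarrow> bool" where
  "homogeneous d p \<longleftrightarrow> (\<forall>m\<in>Poly_Mapping.keys p. pmonom_deg m = d)"

definition poly_ring :: "(nat \<times> nat) set \<Rightarrow> 'k::comm_ring_1 mpoly ring" where
  "poly_ring V =
     \<lparr>carrier = {p. \<forall>m\<in>Poly_Mapping.keys p. Poly_Mapping.keys m \<subseteq> V},
      mult = (*), one = 1, zero = 0, add = (+)\<rparr>"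

text \<open>\<open>K[X]\<close> and \<open>K[X\<^sub>n]\<close>; rows and columns are counted from 1.\<close>

definition KX :: "nat \<Rightarrow> 'k::comm_ring_1 mpoly ring" where
  "KX c = poly_ring ({1..c} \<times> {1..})"

definition KXn :: "nat \<Rightarrow> nat \<Rightarrow> 'k::comm_ring_1 mpoly ring" where
  "KXn c n = poly_ring ({1..c} \<times> {1..n})"

text \<open>The value at 0, which is not a positive integer, is unconstrained and irrelevant.\<close>

definition Inc :: "(nat \<Rightarrow> nat) set" where
  "Inc = {\<pi>. \<forall>i\<ge>1. 1 \<le> \<pi> i \<and> \<pi> i < \<pi> (Suc i)}"

text \<open>The \<open>K\<close>-algebra endomorphism substituting \<open>x\<^sub>i\<^sub>,\<^sub>\<pi>\<^sub>(\<^sub>j\<^sub>)\<close> for \<open>x\<^sub>i\<^sub>,\<^sub>j\<close>.\<close>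

definition inc_act :: "(nat \<Rightarrow> nat) \<Rightarrow> 'k::comm_ring_1 mpoly \<Rightarrow> 'k mpoly" where
  "inc_act \<pi> p =
     (\<Sum>m\<in>Poly_Mapping.keys p.
        pconst (Poly_Mapping.lookup p m) *
        (\<Prod>(i, j)\<in>Poly_Mapping.keys m. pvar i (\<pi> j) ^ Poly_Mapping.lookup m (i, j)))"

definition orbit_ideal :: "nat \<Rightarrow> 'k::comm_ring_1 mpoly \<Rightarrow> 'k mpoly set" where
  "orbit_ideal c p = Idl\<^bsub>KX c\<^esub> ((\<lambda>\<pi>. inc_act \<pi> p) ` Inc)"

definition matrix_monomial :: "nat \<Rightarrow> nat \<Rightarrow> (nat \<Rightarrow> nat \<Rightarrow> nat) \<Rightarrow> 'k::comm_ring_1 mpoly" where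
  "matrix_monomial c l a = (\<Prod>i=1..c. \<Prod>j=1..l. pvar i j ^ a i j)"

definition trunc_ideal :: "nat \<Rightarrow> 'k::comm_ring_1 mpoly set \<Rightarrow> nat \<Rightarrow> 'k mpoly set" where
  "trunc_ideal c I n = I \<inter> carrier (KXn c n)"

definition trunc_quot :: "nat \<Rightarrow> 'k::comm_ring_1 mpoly set \<Rightarrow> nat \<Rightarrow> 'k mpoly set ring" where
  "trunc_quot c I n = KXn c n Quot trunc_ideal c I n"

definition residue_class ::
    "nat \<Rightarrow> 'k::comm_ring_1 mpoly set \<Rightarrow> nat \<Rightarrow> 'k mpoly \<Rightarrow> 'k mpoly set" where
  "residue_class c I n p = trunc_ideal c I n +>\<^bsub>KXn c n\<^esub> p"

text \<open>
  The degree \<open>j\<close> component of \<open>K[X\<^sub>n]/I\<^sub>n\<close> is the image of the degree \<open>j\<close> component of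
  \<open>K[X\<^sub>n]\<close>. Its dimension is taken over the copy of \<open>K\<close> inside the quotient ring.
\<close>

definition quot_component ::
    "nat \<Rightarrow> 'k::comm_ring_1 mpoly set \<Rightarrow> nat \<Rightarrow> nat \<Rightarrow> 'k mpoly set set" where
  "quot_component c I n j = residue_class c I n ` {p \<in> carrier (KXn c n). homogeneous j p}"

definition quot_component_dim :: "nat \<Rightarrow> 'k::field mpoly set \<Rightarrow> nat \<Rightarrow> nat \<Rightarrow> nat" where
  "quot_component_dim c I n j =
     ring.dim (trunc_quot c I n)
       (residue_class c I n ` Set.range pconst) (quot_component c I n j)"

text \<open>
  Both \<open>\<int>[s,t]\<close> and \<open>\<int>[[s,t]]\<close> are iterated, with \<open>s\<close> the outer and \<open>t\<close> the inner variable.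
\<close>

definition equivariant_hilbert_series :: "nat \<Rightarrow> 'k::field mpoly set \<Rightarrow> int fps fps" where
  "equivariant_hilbert_series c I =
     Abs_fps (\<lambda>n. Abs_fps (\<lambda>j. int (quot_component_dim c I n j)))"

definition svar :: "int poly poly" where "svar = [:0, 1:]"
definition tvar :: "int poly poly" where "tvar = [:[:0, 1:]:]"

definition bi_fps :: "int poly poly \<Rightarrow> int fps fps" where
  "bi_fps p = fps_of_poly (map_poly fps_of_poly p)"

text \<open>The equation characterising the polynomial \<open>g\<close> for the data \<open>r, c, b, \<mu>\<close>.\<close>

definition hilbert_num_eq ::
    "nat \<Rightarrow> nat \<Rightarrow> (nat \<Rightarrow> nat) \<Rightarrow> (nat \<Rightarrow> nat) \<Rightarrow> int poly poly \<Rightarrow> bool" where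
  "hilbert_num_eq r c b \<mu> g \<longleftrightarrow>
     g * ((1 - tvar) ^ c - svar) =
       (1 - tvar) ^ (c * (\<mu> r - r)) * (\<Prod>j=1..r. (1 - tvar) ^ c - svar + svar * tvar ^ b j)
       - svar ^ \<mu> r * tvar ^ (\<Sum>j=1..r. b j)"

text \<open>The exponent of \<open>1 - t\<close> in the denominator, which may be negative.\<close>

definition hilbert_exp :: "nat \<Rightarrow> nat \<Rightarrow> (nat \<Rightarrow> nat) \<Rightarrow> int" where
  "hilbert_exp r c \<mu> = int c * (int (\<mu> r) - int r - 1) + int r"

text \<open>
  Numerator and denominator of the rational function. At most one of the exponents \<open>nat (- e)\<close>
  and \<open>nat e\<close> is nonzero: a negative power of \<open>1 - t\<close> is moved to the numerator.
\<close>

definition hilbert_num ::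
    "nat \<Rightarrow> nat \<Rightarrow> (nat \<Rightarrow> nat) \<Rightarrow> int poly poly \<Rightarrow> int poly poly" where
  "hilbert_num r c \<mu> g = (1 - tvar) ^ nat (- hilbert_exp r c \<mu>) * g"

definition hilbert_den ::
    "nat \<Rightarrow> nat \<Rightarrow> (nat \<Rightarrow> nat) \<Rightarrow> (nat \<Rightarrow> nat) \<Rightarrow> int poly poly" where
  "hilbert_den r c b \<mu> =
     (1 - tvar) ^ nat (hilbert_exp r c \<mu>) *
     (\<Prod>j=1..r. (1 - tvar) ^ (c - 1) - svar * (\<Sum>k<b j. tvar ^ k))"

text \<open>The power series \<open>H\<close> is the quotient \<open>p/q\<close>, formed in \<open>\<int>[[s,t]]\<close>, where \<open>q\<close> is a unit.\<close>

definition is_fps_quotient :: "int fps fps \<Rightarrow> int poly poly \<Rightarrow> int poly poly \<Rightarrow> bool" where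
  "is_fps_quotient H p q \<longleftrightarrow> bi_fps q dvd 1 \<and> H * bi_fps q = bi_fps p"

end

(*
A monomial of K[X_n] is a word of n columns, and it lies in the ideal I iff the word of columns of
x^a embeds into it (order-preservingly and componentwise). The residue classes of the other
monomials form a basis of K[X_n]/I_n, so H counts the words avoiding an embedding.

An embedding exists iff the greedy one does. Let H(A) be the series of words avoiding A, put
u = (1 - t)^c, and split off the first column of a word. A column above x contributes s t^|x| / u,
every other one s (1 - t^|x|) / u, which gives
(u - s + s t^|x|) H(x # xs) = u + s t^|x| H(xs),
and hence the product formula for H by induction on the pattern. A zero column of the pattern
contributes the factor u.

With (1 - t) F_j = D_j, where D_j = (1 - t)^c - s + s t^(b_j), a common divisor of g and F_j, or of
g and 1 - t, divides every term of the equation defining g but the last one, hence divides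
s^(mu_r) t^(sum b). But s, t and 1 - t are primes, none of s, t, 1 - t divides F_j, and 1 - t divides
neither s nor t.
*)
theory Submission
  imports Defs "HOL-Library.Sublist"
begin

unbundle fps_syntax

section \<open>Counting by weight\<close>

text \<open>Since \<open>card\<close> is 0 on infinite sets, this condition accompanies every series
  below; additivity and multiplicativity of \<open>weight_series\<close> are proved under
  it.\<close>

definition fin_fibres :: "'x set \<Rightarrow> ('x \<Rightarrow> nat) \<Rightarrow> bool" where
  "fin_fibres A w \<longleftrightarrow> (\<forall>d. finite {x \<in> A. w x = d})"

definition weight_series :: "'x set \<Rightarrow> ('x \<Rightarrow> nat) \<Rightarrow> int fps" where
  "weight_series A w = Abs_fps (\<lambda>d. int (card {x \<in> A. w x = d}))"

lemma weight_series_nth: "weight_series A w $ d = int (card {x \<in> A. w x = d})"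
  by (simp add: weight_series_def)

lemma weight_series_empty [simp]: "weight_series {} w = 0"
  by (simp add: fps_eq_iff weight_series_nth)

lemma fin_fibres_empty [simp]: "fin_fibres {} w"
  by (simp add: fin_fibres_def)

lemma fin_fibres_subset: "fin_fibres B w \<Longrightarrow> A \<subseteq> B \<Longrightarrow> fin_fibres A w"
  unfolding fin_fibres_def by (blast intro: finite_subset[rotated])

lemma fin_fibres_Un: "fin_fibres A w \<Longrightarrow> fin_fibres B w \<Longrightarrow> fin_fibres (A \<union> B) w"
  by (auto simp: fin_fibres_def conj_disj_distribR Collect_disj_eq)

lemma weight_series_Un:
  assumes "fin_fibres A w" "fin_fibres B w" "A \<inter> B = {}"
  shows "weight_series (A \<union> B) w = weight_series A w + weight_series B w"
proof (rule fps_ext)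
  fix d
  have "{x \<in> A \<union> B. w x = d} = {x \<in> A. w x = d} \<union> {x \<in> B. w x = d}" by auto
  moreover have "{x \<in> A. w x = d} \<inter> {x \<in> B. w x = d} = {}" using assms(3) by auto
  ultimately show "weight_series (A \<union> B) w $ d = (weight_series A w + weight_series B w) $ d"
    using assms card_Un_disjoint[of "{x \<in> A. w x = d}" "{x \<in> B. w x = d}"]
    by (force simp: weight_series_nth fin_fibres_def)
qed

lemma weight_series_bij_betw:
  assumes "bij_betw f A B" "\<And>x. x \<in> A \<Longrightarrow> v (f x) = w x"
  shows "weight_series B v = weight_series A w"
proof (rule fps_ext)
  fix d
  have "bij_betw f {x \<in> A. w x = d} {y \<in> B. v y = d}"
    using assms by (auto simp: bij_betw_def inj_on_def)
  then show "weight_series B v $ d = weight_series A w $ d"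
    by (simp add: weight_series_nth bij_betw_same_card)
qed

lemma fin_fibres_bij_betw:
  assumes "bij_betw f A B" "\<And>x. x \<in> A \<Longrightarrow> v (f x) = w x" "fin_fibres A w"
  shows "fin_fibres B v"
proof -
  have "{y \<in> B. v y = d} = f ` {x \<in> A. w x = d}" for d
    using assms by (auto simp: bij_betw_def)
  then show ?thesis
    using assms(3) by (simp add: fin_fibres_def)
qed

text \<open>Splitting the pairs of total weight \<open>d\<close> by the weight \<open>i\<close> of
  the first component gives the Cauchy product.\<close>

lemma
  assumes "fin_fibres A v" "fin_fibres B w"
  shows fin_fibres_Times: "fin_fibres (A \<times> B) (\<lambda>(x, y). v x + w y)" (is ?fin)
    and weight_series_Times:
      "weight_series (A \<times> B) (\<lambda>(x, y). v x + w y) = weight_series A v * weight_series B w" (is ?eq)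
proof -
  have eq: "{z \<in> A \<times> B. (\<lambda>(x, y). v x + w y) z = d} =
      (\<Union>i\<in>{0..d}. {x \<in> A. v x = i} \<times> {y \<in> B. w y = d - i})" for d
    by auto
  show ?fin
    unfolding fin_fibres_def eq using assms by (auto simp: fin_fibres_def)
  show ?eq
  proof (rule fps_ext)
    fix d
    have "card (\<Union>i\<in>{0..d}. {x \<in> A. v x = i} \<times> {y \<in> B. w y = d - i}) =
        (\<Sum>i=0..d. card ({x \<in> A. v x = i} \<times> {y \<in> B. w y = d - i}))"
      using assms by (intro card_UN_disjoint) (auto simp: fin_fibres_def)
    then show "weight_series (A \<times> B) (\<lambda>(x, y). v x + w y) $ d =
        (weight_series A v * weight_series B w) $ d"
      unfolding fps_mult_nth weight_series_nth eq by (simp add: card_cartesian_product)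
  qed
qed

lemma weight_series_singleton: "weight_series {x} w = fps_X ^ w x"
proof (rule fps_ext)
  fix d
  have "{y \<in> {x}. w y = d} = (if d = w x then {x} else {})" by auto
  then show "weight_series {x} w $ d = fps_X ^ w x $ d"
    by (simp add: weight_series_nth)
qed

lemma fin_fibres_atLeast: "fin_fibres {k..} (\<lambda>n. n)"
  by (auto simp: fin_fibres_def)

text \<open>Multiplication by \<open>1 - fps_X\<close> takes differences of consecutive
  coefficients, and only the jump at \<open>k\<close> survives. Here and below quotients are stated
  as products, since \<open>int fps\<close> is not a field.\<close>

lemma weight_series_atLeast: "(1 - fps_X) * weight_series {k..} (\<lambda>n. n) = fps_X ^ k"
proof (rule fps_ext)
  fix d
  have "{n \<in> {k..}. n = i} = (if k \<le> i then {i} else {})" for i :: nat by auto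
  then have "weight_series {k..} (\<lambda>n. n) $ i = (if k \<le> i then 1 else 0)" for i :: nat
    unfolding weight_series_nth by simp
  then show "((1 - fps_X) * weight_series {k..} (\<lambda>n. n)) $ d = fps_X ^ k $ d"
    by (cases d) (auto simp: left_diff_distrib)
qed

section \<open>Columns above a given column\<close>

definition dominating :: "nat list \<Rightarrow> nat list set" where
  "dominating x = {v. list_all2 (\<le>) x v}"

lemma bij_betw_dominating_Cons: "bij_betw (\<lambda>(k, v). k # v) ({n..} \<times> dominating x) (dominating (n # x))"
  by (auto simp: bij_betw_def inj_on_def dominating_def list_all2_Cons1)

lemma fin_fibres_dominating: "fin_fibres (dominating x) sum_list"
proof (induction x)
  case Nil
  then show ?case by (simp add: dominating_def fin_fibres_def)
next
  case (Cons n x)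
  show ?case
    using fin_fibres_bij_betw[OF bij_betw_dominating_Cons, where v = sum_list and w = "\<lambda>(k, v). k + sum_list v"]
      fin_fibres_Times[OF fin_fibres_atLeast Cons.IH] by auto
qed

text \<open>The entries of a dominating column vary independently; an entry bounded below by
  \<open>n\<close> contributes t^n / (1 - t).\<close>

lemma weight_series_dominating:
  "(1 - fps_X) ^ length x * weight_series (dominating x) sum_list = fps_X ^ sum_list x"
proof (induction x)
  case Nil
  have "dominating [] = {[]}" by (auto simp: dominating_def)
  then show ?case by (simp add: weight_series_singleton)
next
  case (Cons n x)
  have "weight_series (dominating (n # x)) sum_list =
      weight_series {n..} (\<lambda>n. n) * weight_series (dominating x) sum_list"
    using weight_series_bij_betw[OF bij_betw_dominating_Cons, where v = sum_list and w = "\<lambda>(k, v). k + sum_list v"]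
      weight_series_Times[OF fin_fibres_atLeast fin_fibres_dominating] by auto
  then have "(1 - fps_X) ^ length (n # x) * weight_series (dominating (n # x)) sum_list =
      ((1 - fps_X) * weight_series {n..} (\<lambda>n. n)) *
      ((1 - fps_X) ^ length x * weight_series (dominating x) sum_list)"
    by (simp add: algebra_simps)
  then show ?case by (simp add: weight_series_atLeast Cons.IH power_add)
qed

lemma dominating_subset: "length x = c \<Longrightarrow> dominating x \<subseteq> {v. length v = c}"
  by (auto simp: dominating_def list_all2_lengthD)

text \<open>This makes the series 1 / (1 - t)^c of all columns the case of a zero column.\<close>

lemma Collect_length_eq_dominating: "{v. length v = c} = dominating (replicate c 0)"
  by (auto simp: dominating_def list_all2_conv_all_nth)

lemma fin_fibres_length: "fin_fibres {v. length v = c} sum_list"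
  by (simp add: Collect_length_eq_dominating fin_fibres_dominating)

lemma fin_fibres_not_dominating: "fin_fibres ({v. length v = c} - dominating x) sum_list"
  by (rule fin_fibres_subset[OF fin_fibres_length[of c]]) auto

lemma weight_series_not_dominating:
  assumes "length x = c"
  shows "(1 - fps_X) ^ c * weight_series ({v. length v = c} - dominating x) sum_list =
    1 - fps_X ^ sum_list x"
proof -
  have "weight_series {v. length v = c} sum_list =
      weight_series (dominating x) sum_list + weight_series ({v. length v = c} - dominating x) sum_list"
    using dominating_subset[OF assms]
    by (subst weight_series_Un[symmetric])
      (auto intro: fin_fibres_dominating fin_fibres_subset[OF fin_fibres_length] arg_cong2[where f = weight_series])
  moreover have "(1 - fps_X) ^ c * weight_series {v. length v = c} sum_list = 1"
    using weight_series_dominating[of "replicate c 0"] by (simp add: Collect_length_eq_dominating sum_list_replicate)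
  ultimately show ?thesis
    using weight_series_dominating[of x] assms by (simp add: algebra_simps)
qed

section \<open>Words of columns avoiding a pattern\<close>

definition avoiding :: "nat \<Rightarrow> nat list list \<Rightarrow> nat \<Rightarrow> nat list list set" where
  "avoiding c A n =
     {vs. length vs = n \<and> set vs \<subseteq> {v. length v = c} \<and> \<not> list_emb (list_all2 (\<le>)) A vs}"

abbreviation total :: "nat list list \<Rightarrow> nat" where
  "total vs \<equiv> sum_list (map sum_list vs)"

text \<open>If \<open>P x y\<close>, matching \<open>x\<close> with \<open>y\<close> loses nothing:
  forgetting the first letter turns an embedding of \<open>x # xs\<close> in \<open>ys\<close> into
  one of \<open>xs\<close> in \<open>ys\<close>. So the first letter of the word alone decides what
  remains of the pattern.\<close>

lemma list_emb_Cons_Cons_greedy: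
  "list_emb P (x # xs) (y # ys) \<longleftrightarrow>
     (if P x y then list_emb P xs ys else list_emb P (x # xs) ys)"
proof -
  have "list_emb P xs ys" if "list_emb P (x # xs) ys"
    using list_emb_ConsD[OF that] by (auto intro: list_emb_append2)
  then show ?thesis by (auto elim: list_emb.cases)
qed

lemma avoiding_Nil [simp]: "avoiding c [] n = {}"
  by (simp add: avoiding_def)

lemma avoiding_Cons_0: "avoiding c (x # xs) 0 = {[]}"
  by (auto simp: avoiding_def)

text \<open>By the greedy rule the head of the pattern is used up exactly when the first column
  dominates it.\<close>

lemma avoiding_Cons_Suc:
  assumes "length x = c"
  shows "avoiding c (x # xs) (Suc n) =
    (\<lambda>(v, vs). v # vs) ` (dominating x \<times> avoiding c xs n) \<union>
    (\<lambda>(v, vs). v # vs) ` (({v. length v = c} - dominating x) \<times> avoiding c (x # xs) n)"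
proof (rule Set.set_eqI)
  fix ws
  show "ws \<in> avoiding c (x # xs) (Suc n) \<longleftrightarrow>
      ws \<in> (\<lambda>(v, vs). v # vs) ` (dominating x \<times> avoiding c xs n) \<union>
        (\<lambda>(v, vs). v # vs) ` (({v. length v = c} - dominating x) \<times> avoiding c (x # xs) n)"
  proof (cases ws)
    case Nil
    then show ?thesis by (auto simp: avoiding_def)
  next
    case (Cons v vs)
    have len: "v \<in> dominating x \<Longrightarrow> length v = c"
      using dominating_subset[OF assms] by blast
    have "ws \<in> (\<lambda>(v, vs). v # vs) ` (S \<times> T) \<longleftrightarrow> v \<in> S \<and> vs \<in> T" for S T
      by (auto simp: Cons)
    moreover have "list_emb (list_all2 (\<le>)) (x # xs) ws \<longleftrightarrow>
        (if v \<in> dominating x then list_emb (list_all2 (\<le>)) xs vs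
         else list_emb (list_all2 (\<le>)) (x # xs) vs)"
      unfolding Cons list_emb_Cons_Cons_greedy dominating_def mem_Collect_eq ..
    ultimately show ?thesis
      unfolding Un_iff using len by (auto simp: avoiding_def Cons)
  qed
qed

lemma bij_betw_Cons_image: "bij_betw (\<lambda>(v, vs). v # vs) (A \<times> B) ((\<lambda>(v, vs). v # vs) ` (A \<times> B))"
  by (auto simp: bij_betw_def inj_on_def)

lemma
  assumes "fin_fibres A sum_list" "fin_fibres B total"
  shows fin_fibres_Cons_image: "fin_fibres ((\<lambda>(v, vs). v # vs) ` (A \<times> B)) total"
    and weight_series_Cons_image: "weight_series ((\<lambda>(v, vs). v # vs) ` (A \<times> B)) total =
      weight_series A sum_list * weight_series B total"
  using fin_fibres_bij_betw[OF bij_betw_Cons_image, where v = total and w = "\<lambda>(v, vs). sum_list v + total vs" and A1 = A and B1 = B]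
    weight_series_bij_betw[OF bij_betw_Cons_image, where v = total and w = "\<lambda>(v, vs). sum_list v + total vs" and A1 = A and B1 = B]
    fin_fibres_Times[OF assms] weight_series_Times[OF assms]
  by auto

text \<open>The induction is nested, on the pattern and then on the length: the recursion always
  shortens the word, but the pattern in only one of its two cases.\<close>

lemma fin_fibres_avoiding:
  assumes "set A \<subseteq> {v. length v = c}"
  shows "fin_fibres (avoiding c A n) total"
  using assms
proof (induction A arbitrary: n)
  case Nil
  then show ?case by simp
next
  case (Cons x xs)
  note IH = Cons
  show ?case
  proof (induction n)
    case 0
    then show ?case by (simp add: avoiding_Cons_0 fin_fibres_def)
  next
    case (Suc n)
    then show ?case
      using IH
      by (subst avoiding_Cons_Suc)
        (auto intro!: fin_fibres_Un fin_fibres_Cons_image fin_fibres_dominating fin_fibres_not_dominating)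
  qed
qed

text \<open>The outer variable is s and marks the number of columns, the inner one is t and marks
  the degree.\<close>

definition avoiding_series :: "nat \<Rightarrow> nat list list \<Rightarrow> int fps fps" where
  "avoiding_series c A = Abs_fps (\<lambda>n. weight_series (avoiding c A n) total)"

lemma avoiding_series_Nil [simp]: "avoiding_series c [] = 0"
  by (simp add: avoiding_series_def fps_eq_iff)

text \<open>The summand 1 counts the empty word, the factor \<open>fps_X\<close> the first column of
  any other word.\<close>

lemma avoiding_series_Cons:
  assumes "length x = c" "set xs \<subseteq> {v. length v = c}"
  shows "avoiding_series c (x # xs) = 1 +
    fps_X * (fps_const (weight_series (dominating x) sum_list) * avoiding_series c xs +
      fps_const (weight_series ({v. length v = c} - dominating x) sum_list) * avoiding_series c (x # xs))"
proof (rule fps_ext, goal_cases)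
  case (1 n)
  show ?case
  proof (cases n)
    case 0
    then show ?thesis by (simp add: avoiding_series_def avoiding_Cons_0 weight_series_singleton)
  next
    case (Suc m)
    have "weight_series (avoiding c (x # xs) (Suc m)) total =
        weight_series (dominating x) sum_list * weight_series (avoiding c xs m) total +
        weight_series ({v. length v = c} - dominating x) sum_list *
          weight_series (avoiding c (x # xs) m) total"
    proof -
      have fin: "fin_fibres (avoiding c xs m) total" "fin_fibres (avoiding c (x # xs) m) total"
        using assms by (auto intro!: fin_fibres_avoiding)
      have "(\<lambda>(v, vs). v # vs) ` (dominating x \<times> avoiding c xs m) \<inter>
          (\<lambda>(v, vs). v # vs) ` (({v. length v = c} - dominating x) \<times> avoiding c (x # xs) m) = {}"
        by auto
      then show ?thesis
        unfolding avoiding_Cons_Suc[OF assms(1)]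
        using fin fin_fibres_dominating[of x] fin_fibres_not_dominating[of c x]
        by (simp add: weight_series_Un fin_fibres_Cons_image weight_series_Cons_image)
    qed
    then show ?thesis by (simp add: Suc avoiding_series_def)
  qed
qed

text \<open>Solved for the series, this reads u / (u - s) * (1 - s^l t^d / P), where P is the
  product and l and d are the length and total of the pattern. For the empty pattern both sides
  vanish, as it embeds into every word.\<close>

lemma avoiding_series_eq:
  assumes "set A \<subseteq> {v. length v = c}"
  defines "u \<equiv> fps_const ((1 - fps_X) ^ c) :: int fps fps"
    and "t \<equiv> fps_const fps_X :: int fps fps"
  shows "(\<Prod>x\<leftarrow>A. u - fps_X + fps_X * t ^ sum_list x) * (u - fps_X) * avoiding_series c A =
    u * ((\<Prod>x\<leftarrow>A. u - fps_X + fps_X * t ^ sum_list x) - fps_X ^ length A * t ^ total A)"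
  using assms(1)
proof (induction A)
  case Nil
  then show ?case by simp
next
  case (Cons x xs)
  define H where "H = avoiding_series c (x # xs)"
  define D where "D = u - fps_X + fps_X * t ^ sum_list x"
  define Q where "Q = (\<Prod>x\<leftarrow>xs. u - fps_X + fps_X * t ^ sum_list x)"
  have len: "length x = c" using Cons.prems by simp
  have hit: "u * fps_const (weight_series (dominating x) sum_list) = t ^ sum_list x"
    using weight_series_dominating[of x] len
    by (simp add: u_def t_def fps_const_power)
  have miss: "u * fps_const (weight_series ({v. length v = c} - dominating x) sum_list) =
      1 - t ^ sum_list x"
    using weight_series_not_dominating[OF len]
    by (simp add: u_def t_def fps_const_power)
  have "u * H = u + fps_X * ((u * fps_const (weight_series (dominating x) sum_list)) * avoiding_series c xs +
      (u * fps_const (weight_series ({v. length v = c} - dominating x) sum_list)) * H)"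
    unfolding H_def using Cons.prems by (subst avoiding_series_Cons) (auto simp: algebra_simps)
  \<comment> \<open>Collecting the terms with \<open>H\<close> on the left leaves the coefficient u
    - s (1 - t^|x|), which is \<open>D\<close>.\<close>
  then have DH: "D * H = u + fps_X * t ^ sum_list x * avoiding_series c xs"
    unfolding hit miss D_def by (simp add: algebra_simps)
  have IH: "Q * (u - fps_X) * avoiding_series c xs = u * (Q - fps_X ^ length xs * t ^ total xs)"
    using Cons unfolding Q_def by simp
  have "D * Q * (u - fps_X) * H = Q * (u - fps_X) * (D * H)" by (simp add: mult_ac)
  also have "\<dots> = Q * (u - fps_X) * u +
      fps_X * t ^ sum_list x * (Q * (u - fps_X) * avoiding_series c xs)"
    unfolding DH by (simp add: algebra_simps)
  \<comment> \<open>After the induction hypothesis the two terms with \<open>Q\<close> combine to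
    \<open>D * Q\<close>, by the definition of \<open>D\<close>.\<close>
  also have "\<dots> = u * (D * Q - fps_X ^ Suc (length xs) * t ^ (sum_list x + total xs))"
    unfolding IH D_def by (simp add: algebra_simps power_add)
  finally show ?case by (simp add: H_def D_def Q_def)
qed

section \<open>The rational function\<close>

lemma fps_dvd_1: "f $ 0 dvd 1 \<Longrightarrow> f dvd 1" for f :: "'a :: comm_ring_1 fps"
  using fps_right_inverse[of f] by (metis dvdE dvdI)

section \<open>The embedding of Z[s,t] into Z[[s,t]]\<close>

lemma bi_fps_nth: "bi_fps p $ n = fps_of_poly (Polynomial.coeff p n)"
  by (simp add: bi_fps_def coeff_map_poly)

lemma bi_fps_1 [simp]: "bi_fps 1 = 1"
  by (rule fps_ext) (simp add: bi_fps_nth)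

lemma bi_fps_add [simp]: "bi_fps (p + q) = bi_fps p + bi_fps q"
  by (rule fps_ext) (simp add: bi_fps_nth fps_of_poly_add)

lemma bi_fps_diff [simp]: "bi_fps (p - q) = bi_fps p - bi_fps q"
  by (rule fps_ext) (simp add: bi_fps_nth fps_of_poly_diff)

lemma bi_fps_mult [simp]: "bi_fps (p * q) = bi_fps p * bi_fps q"
  by (rule fps_ext)
    (simp add: bi_fps_nth coeff_mult fps_mult_nth fps_of_poly_sum fps_of_poly_mult atLeast0AtMost)

lemma bi_fps_power [simp]: "bi_fps (p ^ n) = bi_fps p ^ n"
  by (induction n) auto

lemma bi_fps_prod [simp]: "bi_fps (prod f A) = (\<Prod>x\<in>A. bi_fps (f x))"
  by (induction A rule: infinite_finite_induct) auto

lemma bi_fps_svar [simp]: "bi_fps svar = fps_X"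
  by (rule fps_ext) (auto simp: bi_fps_nth svar_def coeff_pCons split: nat.splits)

lemma bi_fps_tvar [simp]: "bi_fps tvar = fps_const fps_X"
  by (rule fps_ext) (auto simp: bi_fps_nth tvar_def coeff_pCons split: nat.splits)

lemma bi_fps_eq_0_iff: "bi_fps p = 0 \<longleftrightarrow> p = 0"
  by (auto simp: fps_eq_iff poly_eq_iff bi_fps_nth)

section \<open>The primes s, t and 1 - t\<close>

lemma prime_elem_linear_poly: "prime_elem [:- a, 1:]" for a :: "'a :: idom"
  by (rule prime_elemI) (auto simp: poly_eq_0_iff_dvd[symmetric] poly_eq_0_iff_dvd[of 1, symmetric, simplified])

lemma one_minus_tvar: "1 - tvar = [:[:1, -1:]:]"
  by (simp add: tvar_def one_pCons)

lemma one_minus_tvar_power: "(1 - tvar) ^ k = [:[:1, -1:] ^ k:]"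
  by (simp add: one_minus_tvar poly_const_pow)

lemma prime_elem_svar: "prime_elem svar"
  using prime_elem_linear_poly[of "0 :: int poly"] by (simp add: svar_def)

lemma prime_elem_tvar: "prime_elem tvar"
  using prime_elem_linear_poly[of "0 :: int"] by (simp add: tvar_def lift_prime_elem_poly)

lemma linear_poly_dvd_iff: "[:1, -1:] dvd p \<longleftrightarrow> poly p 1 = 0" for p :: "int poly"
proof -
  have "[:1, -1:] = - [:- 1, 1 :: int:]" by simp
  then show ?thesis by (metis minus_dvd_iff poly_eq_0_iff_dvd)
qed

text \<open>The polynomial is constant in s, and a prime of Z[t] stays prime in Z[t][s].\<close>

lemma prime_elem_one_minus_tvar: "prime_elem (1 - tvar)"
proof -
  have "prime_elem [:1, - 1 :: int:]"
    by (rule prime_elemI) (auto simp: linear_poly_dvd_iff)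
  then show ?thesis by (simp add: one_minus_tvar lift_prime_elem_poly)
qed

text \<open>Divisibility by a constant polynomial is tested on coefficients, so one coefficient in s
  with nonzero value at t = 1 refutes it.\<close>

lemma one_minus_tvar_dvd_iff: "1 - tvar dvd p \<longleftrightarrow> (\<forall>n. poly (Polynomial.coeff p n) 1 = 0)"
  by (simp add: one_minus_tvar const_poly_dvd_iff linear_poly_dvd_iff)

lemma tvar_dvd_iff: "tvar dvd p \<longleftrightarrow> (\<forall>n. poly (Polynomial.coeff p n) 0 = 0)"
  using poly_eq_0_iff_dvd[of _ "0 :: int"] by (simp add: tvar_def const_poly_dvd_iff)

lemma svar_dvd_iff: "svar dvd p \<longleftrightarrow> Polynomial.coeff p 0 = 0"
  using poly_eq_0_iff_dvd[of p 0] by (simp add: svar_def poly_0_coeff_0)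

text \<open>For \<open>k = b j\<close> this is the F_j of the opening overview.\<close>

definition den_factor :: "nat \<Rightarrow> nat \<Rightarrow> int poly poly" where
  "den_factor c k = (1 - tvar) ^ (c - 1) - svar * (\<Sum>i<k. tvar ^ i)"

lemma tvar_sum: "(\<Sum>i<k. tvar ^ i) = [:(\<Sum>i<k. [:0, 1:] ^ i):]"
  by (induction k) (simp_all add: tvar_def poly_const_pow)

lemma den_factor_eq: "den_factor c k = [:[:1, -1:] ^ (c - 1), - (\<Sum>i<k. [:0, 1:] ^ i):]"
  by (simp add: den_factor_def one_minus_tvar_power tvar_sum svar_def)

lemma one_minus_tvar_times_den_factor:
  assumes "1 \<le> c"
  shows "(1 - tvar) * den_factor c k = (1 - tvar) ^ c - svar + svar * tvar ^ k"
proof -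
  have "(1 - tvar) * den_factor c k =
      (1 - tvar) ^ Suc (c - 1) - svar * ((1 - tvar) * (\<Sum>i<k. tvar ^ i))"
    by (simp add: den_factor_def algebra_simps)
  then show ?thesis
    using assms unfolding one_diff_power_eq[symmetric] by (simp add: algebra_simps)
qed

text \<open>A prime is coprime to whatever it does not divide. The coefficient of s^0 is (1 - t)^(c
  - 1), nonzero and equal to 1 at t = 0; the coefficient of s is -(1 + ... + t^(k - 1)), equal to -k
  at t = 1.\<close>

lemma coprime_den_factor:
  assumes "0 < k"
  shows "coprime svar (den_factor c k)"
    and "coprime tvar (den_factor c k)"
    and "coprime (1 - tvar) (den_factor c k)"
proof -
  have "\<not> svar dvd den_factor c k"
    by (simp add: svar_dvd_iff den_factor_eq)
  then show "coprime svar (den_factor c k)"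
    by (intro prime_elem_imp_coprime prime_elem_svar)
  have "poly (Polynomial.coeff (den_factor c k) 0) 0 \<noteq> 0"
    by (simp add: den_factor_eq poly_power)
  then show "coprime tvar (den_factor c k)"
    by (intro prime_elem_imp_coprime prime_elem_tvar) (auto simp: tvar_dvd_iff)
  have "poly (Polynomial.coeff (den_factor c k) 1) 1 \<noteq> 0"
    using assms by (simp add: den_factor_eq poly_sum poly_power)
  then show "coprime (1 - tvar) (den_factor c k)"
    by (intro prime_elem_imp_coprime prime_elem_one_minus_tvar) (auto simp: one_minus_tvar_dvd_iff)
qed

lemma coprime_svar_tvar_one_minus_tvar: "coprime (1 - tvar) svar" "coprime (1 - tvar) tvar"
proof -
  have "poly (Polynomial.coeff svar 1) 1 \<noteq> 0" "poly (Polynomial.coeff tvar 0) 1 \<noteq> 0"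
    by (simp_all add: svar_def tvar_def)
  then show "coprime (1 - tvar) svar" "coprime (1 - tvar) tvar"
    by (auto intro!: prime_elem_imp_coprime prime_elem_one_minus_tvar simp: one_minus_tvar_dvd_iff)
qed

lemma cofactor_nonzero: "(1 - tvar) ^ c - svar \<noteq> 0"
proof
  assume "(1 - tvar) ^ c - svar = 0"
  then have "Polynomial.coeff ((1 - tvar) ^ c - svar) 1 = 0" by simp
  then show False by (simp add: one_minus_tvar_power svar_def)
qed

text \<open>Existence is the factor theorem: the right-hand side vanishes at s = (1 - t)^c, where
  every factor of the product becomes (1 - t)^c t^(b j). Uniqueness is cancellation of a nonzero
  polynomial.\<close>

lemma ex1_hilbert_num_eq:
  assumes "r \<le> \<mu> r"
  shows "\<exists>!g. hilbert_num_eq r c b \<mu> g"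
proof -
  define u where "u = ([:1, -1:] :: int poly) ^ c"
  define R where "R = (1 - tvar) ^ (c * (\<mu> r - r)) *
    (\<Prod>j=1..r. (1 - tvar) ^ c - svar + svar * tvar ^ b j) -
    svar ^ \<mu> r * tvar ^ (\<Sum>j=1..r. b j)"
  have eval: "poly svar u = u" "poly tvar u = [:0, 1:]" "(1 - [:0, 1:]) ^ c = u"
    by (simp_all add: tvar_def svar_def u_def one_pCons)
  have "poly R u = u ^ (\<mu> r - r) * (u ^ r * [:0, 1:] ^ (\<Sum>j=1..r. b j)) -
      u ^ \<mu> r * [:0, 1:] ^ (\<Sum>j=1..r. b j)"
    by (simp add: R_def poly_prod poly_power prod.distrib power_sum power_mult eval)
  \<comment> \<open>By \<open>r \<le> \<mu> r\<close> the exponents of \<open>u\<close> add up to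
    \<open>\<mu> r\<close> in the first term.\<close>
  also have "\<dots> = 0"
    using assms by (simp add: mult.assoc[symmetric] power_add[symmetric])
  finally have "[:- u, 1:] dvd R" by (simp add: poly_eq_0_iff_dvd)
  moreover have "(1 - tvar) ^ c - svar = - [:- u, 1:]"
    by (simp add: one_minus_tvar_power svar_def u_def)
  ultimately have "(1 - tvar) ^ c - svar dvd R" by (simp only: minus_dvd_iff)
  then obtain g where "R = ((1 - tvar) ^ c - svar) * g" by (elim dvdE)
  then have "hilbert_num_eq r c b \<mu> g"
    by (simp add: hilbert_num_eq_def R_def mult.commute)
  moreover have "g' = g''" if "hilbert_num_eq r c b \<mu> g'" "hilbert_num_eq r c b \<mu> g''" for g' g''
    using that cofactor_nonzero[of c] unfolding hilbert_num_eq_def by (metis mult_right_cancel)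
  ultimately show ?thesis by blast
qed

lemma hilbert_den_eq:
  "hilbert_den r c b \<mu> = (1 - tvar) ^ nat (hilbert_exp r c \<mu>) * (\<Prod>j=1..r. den_factor c (b j))"
  by (simp add: hilbert_den_def den_factor_def)

text \<open>Coprimality passes to products, so \<open>g\<close> is compared with each
  \<open>den_factor\<close> and with \<open>1 - tvar\<close> separately.\<close>

lemma coprime_hilbert_num_den:
  assumes "1 \<le> c" "1 \<le> r" "\<And>j. j \<in> {1..r} \<Longrightarrow> 0 < b j" "hilbert_num_eq r c b \<mu> g"
  shows "coprime (hilbert_num r c \<mu> g) (hilbert_den r c b \<mu>)"
proof -
  define Q where "Q = (1 - tvar) ^ (c * (\<mu> r - r)) *
    (\<Prod>j=1..r. (1 - tvar) ^ c - svar + svar * tvar ^ b j)"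
  define st where "st = svar ^ \<mu> r * tvar ^ (\<Sum>j=1..r. b j)"
  have st: "p dvd st" if "p dvd g" "p dvd Q" for p
  proof -
    have "p dvd Q - g * ((1 - tvar) ^ c - svar)" using that by (simp add: dvd_diff)
    then show ?thesis using assms(4) by (simp add: hilbert_num_eq_def Q_def st_def)
  qed
  \<comment> \<open>The bound on \<open>p\<close> is a factor of \<open>Q\<close>; stating it as a
    product covers divisors of \<open>1 - tvar\<close> and of \<open>den_factor\<close>
    alike.\<close>
  have Q: "p dvd Q" if "j \<in> {1..r}" "p dvd (1 - tvar) * den_factor c (b j)" for p j
  proof -
    have "p dvd (\<Prod>j=1..r. (1 - tvar) ^ c - svar + svar * tvar ^ b j)"
      using that unfolding one_minus_tvar_times_den_factor[OF assms(1)]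
      by (intro dvd_trans[OF _ dvd_prodI[OF _ that(1)]]) auto
    then show ?thesis by (simp add: Q_def)
  qed
  have cop_den: "coprime g (den_factor c (b j))" if j: "j \<in> {1..r}" for j
  proof (rule coprimeI)
    fix p assume p: "p dvd g" "p dvd den_factor c (b j)"
    then have "p dvd st" by (intro st Q[OF j]) auto
    moreover have "coprime st (den_factor c (b j))"
      using coprime_den_factor[OF assms(3)[OF j]] by (simp add: st_def)
    ultimately show "is_unit p"
      using p(2) by (blast dest: coprime_common_divisor)
  qed
  have "coprime (1 - tvar) g"
  proof (rule coprimeI)
    fix p assume p: "p dvd 1 - tvar" "p dvd g"
    \<comment> \<open>By \<open>1 \<le> r\<close> the product in \<open>Q\<close> has a factor with
      index 1, and \<open>1 - tvar\<close> divides it.\<close>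
    then have "p dvd st" using assms(2) by (intro st Q[of 1]) auto
    moreover have "coprime (1 - tvar) st"
      using coprime_svar_tvar_one_minus_tvar by (simp add: st_def)
    ultimately show "is_unit p"
      using p(1) by (blast dest: coprime_common_divisor)
  qed
  then have "coprime g ((1 - tvar) ^ k)" for k by (simp add: coprime_commute)
  \<comment> \<open>Hence \<open>1 - tvar\<close> never enters both numerator and denominator
    through these powers.\<close>
  moreover have "nat (- hilbert_exp r c \<mu>) = 0 \<or> nat (hilbert_exp r c \<mu>) = 0" by linarith
  moreover have "coprime (1 - tvar) (\<Prod>j=1..r. den_factor c (b j))"
    by (intro prod_coprime_right coprime_den_factor(3) assms(3))
  moreover have "coprime g (\<Prod>j=1..r. den_factor c (b j))"
    by (intro prod_coprime_right cop_den)
  ultimately show ?thesis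
    unfolding hilbert_num_def hilbert_den_eq by auto
qed

text \<open>For \<open>\<mu> r = r\<close> the exponent is r - c; otherwise the multiple of c is
  nonnegative and the exponent is at least r.\<close>

lemma hilbert_exp_neg_iff:
  assumes "1 \<le> r" "r \<le> \<mu> r"
  shows "hilbert_exp r c \<mu> < 0 \<longleftrightarrow> r < c \<and> \<mu> r = r"
proof (cases "\<mu> r = r")
  case True
  then show ?thesis by (simp add: hilbert_exp_def)
next
  case False
  then have "int c * (int (\<mu> r) - int r - 1) \<ge> 0" using assms by simp
  then show ?thesis using False assms unfolding hilbert_exp_def by linarith
qed

text \<open>The exponent is c (\<mu> r - r) + r - c. Putting its positive and negative parts on
  opposite sides keeps the comparison within the natural numbers.\<close>

lemma nat_hilbert_exp:
  assumes "r \<le> \<mu> r"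
  shows "nat (hilbert_exp r c \<mu>) + c = nat (- hilbert_exp r c \<mu>) + (c * (\<mu> r - r) + r)"
proof -
  have "int (c * (\<mu> r - r)) = int c * (int (\<mu> r) - int r)" using assms by (simp add: of_nat_diff)
  then have "hilbert_exp r c \<mu> + int c = int (c * (\<mu> r - r)) + int r"
    by (simp add: hilbert_exp_def algebra_simps)
  then show ?thesis by linarith
qed

text \<open>Here \<open>H\<close> is any series satisfying the denominator-free equation. First (1 -
  t)^c - s and then (1 - t)^c is cancelled, both being nonzero in the integral domain
  Z[[s,t]].\<close>

lemma is_fps_quotient_hilbert:
  fixes H :: "int fps fps" and c r :: nat and b \<mu> :: "nat \<Rightarrow> nat"
  defines "u \<equiv> fps_const ((1 - fps_X) ^ c) :: int fps fps"
    and "t \<equiv> fps_const fps_X :: int fps fps"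
  assumes "1 \<le> c" "r \<le> \<mu> r" "\<And>j. j \<in> {1..r} \<Longrightarrow> 0 < b j" "hilbert_num_eq r c b \<mu> g"
    and H: "(u ^ (\<mu> r - r) * (\<Prod>j=1..r. u - fps_X + fps_X * t ^ b j)) * (u - fps_X) * H =
      u * (u ^ (\<mu> r - r) * (\<Prod>j=1..r. u - fps_X + fps_X * t ^ b j) -
        fps_X ^ \<mu> r * t ^ (\<Sum>j=1..r. b j))"
  shows "is_fps_quotient H (hilbert_num r c \<mu> g) (hilbert_den r c b \<mu>)"
proof -
  define F where "F = (\<Prod>j=1..r. den_factor c (b j))"
  define D where "D = (1 - tvar) ^ (c * (\<mu> r - r)) *
    (\<Prod>j=1..r. (1 - tvar) ^ c - svar + svar * tvar ^ b j)"
  have u: "u = bi_fps ((1 - tvar) ^ c)"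
    unfolding u_def bi_fps_power bi_fps_diff bi_fps_1 bi_fps_tvar
    by (metis fps_const_1_eq_1 fps_const_power fps_const_sub)
  have D: "D = (1 - tvar) ^ (c * (\<mu> r - r) + r) * F"
    unfolding D_def F_def one_minus_tvar_times_den_factor[OF assms(3), symmetric] prod.distrib
    by (simp add: power_add mult.assoc)
  have "bi_fps D = u ^ (\<mu> r - r) * (\<Prod>j=1..r. u - fps_X + fps_X * t ^ b j)"
    by (simp add: D_def u t_def power_mult)
  then have "bi_fps D * bi_fps ((1 - tvar) ^ c - svar) * H =
      bi_fps ((1 - tvar) ^ c) * bi_fps (D - svar ^ \<mu> r * tvar ^ (\<Sum>j=1..r. b j))"
    using H by (simp add: u t_def)
  also have "D - svar ^ \<mu> r * tvar ^ (\<Sum>j=1..r. b j) = g * ((1 - tvar) ^ c - svar)"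
    using assms(6) by (simp add: hilbert_num_eq_def D_def)
  finally have "bi_fps ((1 - tvar) ^ c - svar) * (bi_fps D * H) =
      bi_fps ((1 - tvar) ^ c - svar) * (bi_fps ((1 - tvar) ^ c) * bi_fps g)"
    by (simp only: bi_fps_mult mult_ac)
  then have DH: "bi_fps D * H = bi_fps ((1 - tvar) ^ c) * bi_fps g"
    using cofactor_nonzero[of c] unfolding mult_cancel_left bi_fps_eq_0_iff by simp
  define e where "e = nat (hilbert_exp r c \<mu>)"
  define e' where "e' = nat (- hilbert_exp r c \<mu>)"
  have e: "e + c = e' + (c * (\<mu> r - r) + r)"
    using nat_hilbert_exp[of r \<mu> c] assms(4) by (simp add: e_def e'_def)
  \<comment> \<open>The extra factor (1 - t)^c lets \<open>e\<close> treat both signs of the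
    exponent at once; it is cancelled at the end.\<close>
  have "bi_fps ((1 - tvar) ^ c) * (H * bi_fps (hilbert_den r c b \<mu>)) =
      H * bi_fps ((1 - tvar) ^ (e + c) * F)"
    by (simp only: hilbert_den_eq F_def[symmetric] e_def[symmetric] power_add bi_fps_mult mult_ac)
  also have "\<dots> = bi_fps ((1 - tvar) ^ e') * (bi_fps D * H)"
    unfolding e D by (simp only: power_add bi_fps_mult mult_ac)
  also have "\<dots> = bi_fps ((1 - tvar) ^ c) * bi_fps (hilbert_num r c \<mu> g)"
    unfolding DH hilbert_num_def e'_def[symmetric] by (simp only: bi_fps_mult mult_ac)
  finally have "H * bi_fps (hilbert_den r c b \<mu>) = bi_fps (hilbert_num r c \<mu> g)"
    using prime_elem_one_minus_tvar unfolding mult_cancel_left bi_fps_eq_0_iff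
    by (auto simp: prime_elem_def)
  moreover have "bi_fps (hilbert_den r c b \<mu>) dvd 1"
  proof -
    \<comment> \<open>At s = t = 0 every factor of the denominator is 1.\<close>
    have "poly (Polynomial.coeff (hilbert_den r c b \<mu>) 0) 0 = 1"
      by (simp add: hilbert_den_eq one_minus_tvar_power den_factor_eq poly_prod poly_power
          flip: poly_0_coeff_0)
    then have "bi_fps (hilbert_den r c b \<mu>) $ 0 $ 0 dvd 1"
      by (simp add: bi_fps_nth poly_0_coeff_0)
    \<comment> \<open>The rule applies twice, to the series in s and to its constant coefficient, a
      series in t.\<close>
    then show ?thesis by (intro fps_dvd_1)
  qed
  ultimately show ?thesis by (simp add: is_fps_quotient_def)
qed

section \<open>Monomial ideals\<close>

lemma carrier_poly_ring [simp]:
  "p \<in> carrier (poly_ring V) \<longleftrightarrow> (\<forall>m\<in>Poly_Mapping.keys p. Poly_Mapping.keys m \<subseteq> V)"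
  and zero_poly_ring [simp]: "\<zero>\<^bsub>poly_ring V\<^esub> = 0"
  and one_poly_ring [simp]: "\<one>\<^bsub>poly_ring V\<^esub> = 1"
  and add_poly_ring [simp]: "p \<oplus>\<^bsub>poly_ring V\<^esub> q = p + q"
  and mult_poly_ring [simp]: "p \<otimes>\<^bsub>poly_ring V\<^esub> q = p * q"
  by (simp_all add: poly_ring_def)

lemma cring_poly_ring: "cring (poly_ring V :: 'k::comm_ring_1 mpoly ring)" (is "cring ?R")
proof (rule cringI)
  have keys_add': "p + q \<in> carrier ?R" if "p \<in> carrier ?R" "q \<in> carrier ?R" for p q
    using that keys_add[of p q] by auto
  have keys_mult': "p * q \<in> carrier ?R" if "p \<in> carrier ?R" "q \<in> carrier ?R" for p q
  proof -
    have "Poly_Mapping.keys m \<subseteq> V" if "m \<in> Poly_Mapping.keys (p * q)" for m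
    proof -
      obtain m1 m2 where "m = m1 + m2" "m1 \<in> Poly_Mapping.keys p" "m2 \<in> Poly_Mapping.keys q"
        using \<open>m \<in> Poly_Mapping.keys (p * q)\<close> keys_mult[of p q] by blast
      then show ?thesis
        using keys_add[of m1 m2] \<open>p \<in> carrier ?R\<close> \<open>q \<in> carrier ?R\<close> by fastforce
    qed
    then show ?thesis by simp
  qed
  show "abelian_group ?R"
  proof (rule abelian_groupI)
    fix p assume "p \<in> carrier ?R"
    then show "\<exists>q\<in>carrier ?R. q \<oplus>\<^bsub>?R\<^esub> p = \<zero>\<^bsub>?R\<^esub>"
      by (intro bexI[of _ "- p"]) auto
  next
    fix p q assume "p \<in> carrier ?R" "q \<in> carrier ?R"
    then show "p \<oplus>\<^bsub>?R\<^esub> q \<in> carrier ?R" by (simp only: add_poly_ring keys_add')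
  qed (simp_all add: add_ac)
  show "Group.comm_monoid ?R"
  proof (rule comm_monoidI)
    fix p q assume "p \<in> carrier ?R" "q \<in> carrier ?R"
    then show "p \<otimes>\<^bsub>?R\<^esub> q \<in> carrier ?R" by (simp only: mult_poly_ring keys_mult')
  qed (simp_all add: mult_ac)
qed (simp add: distrib_right)

lemma a_minus_poly_ring [simp]:
  assumes "p \<in> carrier (poly_ring V)" "q \<in> carrier (poly_ring V)"
  shows "p \<ominus>\<^bsub>poly_ring V\<^esub> q = p - (q :: 'k::comm_ring_1 mpoly)"
proof -
  interpret cring "poly_ring V :: 'k mpoly ring" by (rule cring_poly_ring)
  have "\<ominus>\<^bsub>poly_ring V\<^esub> q = - q"
    using assms by (intro minus_equality) auto
  then show ?thesis by (simp add: a_minus_def)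
qed

text \<open>It serves to split a single term off a polynomial and to discard the terms lying in an
  ideal.\<close>

definition restrict_support :: "pmonom set \<Rightarrow> 'k::comm_ring_1 mpoly \<Rightarrow> 'k mpoly" where
  "restrict_support M p =
     (\<Sum>m\<in>Poly_Mapping.keys p \<inter> M. Poly_Mapping.single m (Poly_Mapping.lookup p m))"

lemma lookup_restrict_support:
  "Poly_Mapping.lookup (restrict_support M p) m = (if m \<in> M then Poly_Mapping.lookup p m else 0)"
  by (auto simp: restrict_support_def lookup_sum lookup_single when_def sum.delta in_keys_iff)

lemma keys_restrict_support:
  "Poly_Mapping.keys (restrict_support M p) = Poly_Mapping.keys p \<inter> M"
  by (auto simp: in_keys_iff lookup_restrict_support split: if_splits)

lemma poly_mapping_sum_single:
  "p = (\<Sum>m\<in>Poly_Mapping.keys p. Poly_Mapping.single m (Poly_Mapping.lookup p m))"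
  for p :: "'k::comm_ring_1 mpoly"
proof -
  have "p = restrict_support UNIV p"
    by (rule poly_mapping_eqI) (simp add: lookup_restrict_support)
  then show ?thesis by (simp add: restrict_support_def)
qed

text \<open>This is the span of the monomials from \<open>M\<close> in the variables
  \<open>V\<close>; it is an ideal when \<open>M\<close> is closed under multiplication by
  monomials.\<close>

definition monomial_ideal ::
    "(nat \<times> nat) set \<Rightarrow> pmonom set \<Rightarrow> 'k::comm_ring_1 mpoly set" where
  "monomial_ideal V M = {p \<in> carrier (poly_ring V). Poly_Mapping.keys p \<subseteq> M}"

text \<open>Thus I_n is described by the same set of monomials as I.\<close>

lemma monomial_ideal_Int_carrier:
  "V' \<subseteq> V \<Longrightarrow> monomial_ideal V M \<inter> carrier (poly_ring V') = monomial_ideal V' M"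
  unfolding monomial_ideal_def by (auto, blast)

lemma ideal_monomial_ideal:
  assumes "\<And>m m'. m \<in> M \<Longrightarrow> m + m' \<in> M"
  shows "ideal (monomial_ideal V M :: 'k::comm_ring_1 mpoly set) (poly_ring V)"
    (is "ideal ?I ?R")
proof -
  interpret cring ?R by (rule cring_poly_ring)
  have mult: "p * q \<in> ?I" if p: "p \<in> ?I" and q: "q \<in> carrier ?R" for p q
  proof -
    have "Poly_Mapping.keys (p * q) \<subseteq> M"
      using keys_mult[of p q] p assms by (fastforce simp: monomial_ideal_def)
    moreover have "p \<otimes>\<^bsub>?R\<^esub> q \<in> carrier ?R"
      using p q by (intro m_closed) (simp_all add: monomial_ideal_def)
    ultimately show ?thesis by (simp add: monomial_ideal_def)
  qed
  show ?thesis
  proof (rule idealI[OF ring_axioms])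
    show "subgroup ?I (add_monoid ?R)"
    proof (rule add.subgroupI)
      show "?I \<subseteq> carrier ?R" by (auto simp: monomial_ideal_def)
      have "0 \<in> ?I" by (simp add: monomial_ideal_def)
      then show "?I \<noteq> {}" by blast
      fix p assume p: "p \<in> ?I"
      then have "- p \<in> ?I" by (simp add: monomial_ideal_def)
      moreover have "\<ominus>\<^bsub>?R\<^esub> p = - p"
        using p by (intro minus_equality) (auto simp: monomial_ideal_def)
      ultimately show "\<ominus>\<^bsub>?R\<^esub> p \<in> ?I" by simp
      fix q assume q: "q \<in> ?I"
      show "p \<oplus>\<^bsub>?R\<^esub> q \<in> ?I"
        using p q keys_add[of p q]
        unfolding monomial_ideal_def mem_Collect_eq carrier_poly_ring add_poly_ring by blast
    qed
    fix p q assume "p \<in> ?I" "q \<in> carrier ?R"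
    then show "p \<otimes>\<^bsub>?R\<^esub> q \<in> ?I" "q \<otimes>\<^bsub>?R\<^esub> p \<in> ?I"
      using mult[of p q] by (simp_all add: mult.commute)
  qed
qed

lemma genideal_monomials:
  fixes G :: "pmonom set"
  assumes "\<And>m. m \<in> G \<Longrightarrow> Poly_Mapping.keys m \<subseteq> V"
  shows "Idl\<^bsub>poly_ring V\<^esub> ((\<lambda>m. Poly_Mapping.single m (1 :: 'k::comm_ring_1)) ` G) =
    monomial_ideal V {m + m' |m m'. m \<in> G}" (is "Idl\<^bsub>?R\<^esub> ?gens = ?I")
proof
  interpret cring ?R by (rule cring_poly_ring)
  have "?gens \<subseteq> ?I"
  proof
    fix p assume "p \<in> ?gens"
    then obtain m where m: "m \<in> G" "p = Poly_Mapping.single m 1" by blast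
    then have "m + 0 \<in> {m + m' |m m'. m \<in> G}" by blast
    then show "p \<in> ?I" using m assms by (auto simp: monomial_ideal_def)
  qed
  moreover have "ideal ?I ?R"
    by (rule ideal_monomial_ideal) (auto, metis add.assoc)
  ultimately show "Idl\<^bsub>?R\<^esub> ?gens \<subseteq> ?I" by (rule genideal_minimal[rotated])
  have gens: "?gens \<subseteq> carrier ?R" using assms by auto
  interpret J: ideal "Idl\<^bsub>?R\<^esub> ?gens" ?R using gens by (rule genideal_ideal)
  have sum_mem: "(\<Sum>x\<in>A. f x) \<in> Idl\<^bsub>?R\<^esub> ?gens"
    if "finite A" "\<And>x. x \<in> A \<Longrightarrow> f x \<in> Idl\<^bsub>?R\<^esub> ?gens" for A :: "pmonom set" and f
    using that
  proof (induction A)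
    case empty
    then show ?case using J.zero_closed by simp
  next
    case (insert x A)
    then show ?case using J.a_closed[of "f x" "\<Sum>x\<in>A. f x"] by simp
  qed
  show "?I \<subseteq> Idl\<^bsub>?R\<^esub> ?gens"
  proof
    fix p assume p: "p \<in> ?I"
    have "Poly_Mapping.single m k \<in> Idl\<^bsub>?R\<^esub> ?gens" if m: "m \<in> Poly_Mapping.keys p" for m k
    proof -
      obtain g m' where g: "g \<in> G" "m = g + m'" using p m by (auto simp: monomial_ideal_def)
      \<comment> \<open>Exponents cannot cancel, so the cofactor \<open>m'\<close> only involves
        variables of \<open>m\<close> and gives an element of the ring.\<close>
      have "Poly_Mapping.keys m' \<subseteq> Poly_Mapping.keys m"
        by (auto simp: g(2) in_keys_iff lookup_add)
      then have "Poly_Mapping.single m' k \<in> carrier ?R"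
        using p m by (fastforce simp: monomial_ideal_def)
      moreover have "Poly_Mapping.single g 1 \<in> Idl\<^bsub>?R\<^esub> ?gens"
        using genideal_self[OF gens] g(1) by blast
      ultimately have "Poly_Mapping.single m' k \<otimes>\<^bsub>?R\<^esub> Poly_Mapping.single g 1 \<in> Idl\<^bsub>?R\<^esub> ?gens"
        by (intro J.I_l_closed)
      then show ?thesis by (simp add: mult_single g(2) add.commute)
    qed
    then show "p \<in> Idl\<^bsub>?R\<^esub> ?gens"
      by (subst poly_mapping_sum_single) (intro sum_mem, auto)
  qed
qed

section \<open>Dimensions of graded components\<close>

lemma subfield_range_pconst:
  "subfield (Set.range pconst) (poly_ring V :: 'k::field mpoly ring)" (is "subfield ?K ?R")
proof -
  interpret cring ?R by (rule cring_poly_ring)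
  have mult: "pconst x * pconst y = pconst (x * y)"
    and add: "pconst x + pconst y = pconst (x + y)"
    and zero: "(0 :: 'k mpoly) = pconst 0"
    and one: "(1 :: 'k mpoly) = pconst 1"
    and inj: "pconst x = pconst y \<longleftrightarrow> x = y"
    for x y :: 'k
    by (simp_all add: pconst_def mult_single single_add inj_eq)
  have inv: "\<exists>l. k * l = 1" if "k \<noteq> 0" for k :: 'k
    using that by (intro exI[of _ "inverse k"]) simp
  show ?thesis
  proof (rule subfield_iff(1))
    show "?K \<subseteq> carrier ?R" by (auto simp: pconst_def)
    have "cring (?R \<lparr> carrier := ?K \<rparr>)"
    proof (rule cringI)
      show "abelian_group (?R \<lparr> carrier := ?K \<rparr>)"
      proof (rule abelian_groupI)
        fix p assume "p \<in> carrier (?R \<lparr> carrier := ?K \<rparr>)"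
        then obtain k where "p = pconst k" by auto
        then show "\<exists>q\<in>carrier (?R \<lparr> carrier := ?K \<rparr>).
            q \<oplus>\<^bsub>?R \<lparr> carrier := ?K \<rparr>\<^esub> p = \<zero>\<^bsub>?R \<lparr> carrier := ?K \<rparr>\<^esub>"
          by (intro bexI[of _ "pconst (- k)"]) (simp_all add: add zero)
      qed (auto simp: add zero add_ac)
      show "Group.comm_monoid (?R \<lparr> carrier := ?K \<rparr>)"
        by (rule comm_monoidI) (auto simp: mult one mult_ac)
    qed (auto simp: distrib_right)
    then show "field (?R \<lparr> carrier := ?K \<rparr>)"
      by (rule cring.cring_fieldI2) (use inv in \<open>auto simp: mult zero one inj\<close>)
  qed
qed

text \<open>The classes of the degree \<open>d\<close> monomials outside \<open>M\<close> form a
  basis: terms in \<open>M\<close> vanish in the quotient, and a nonzero combination of the other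
  monomials is not supported in \<open>M\<close>.\<close>

lemma dim_quot_monomial_ideal:
  fixes V :: "(nat \<times> nat) set" and M :: "pmonom set"
  defines "R \<equiv> poly_ring V :: 'k::field mpoly ring"
    and "I \<equiv> monomial_ideal V M :: 'k mpoly set"
  assumes up: "\<And>m m'. m \<in> M \<Longrightarrow> m + m' \<in> M" and "0 \<notin> M"
    and fin: "finite {m. Poly_Mapping.keys m \<subseteq> V \<and> pmonom_deg m = d \<and> m \<notin> M}"
  shows "ring.dim (R Quot I) ((+>\<^bsub>R\<^esub>) I ` Set.range pconst)
      ((+>\<^bsub>R\<^esub>) I ` {p \<in> carrier R. homogeneous d p}) =
    card {m. Poly_Mapping.keys m \<subseteq> V \<and> pmonom_deg m = d \<and> m \<notin> M}"
proof -
  define S where "S = {m. Poly_Mapping.keys m \<subseteq> V \<and> pmonom_deg m = d \<and> m \<notin> M}"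
  define \<phi> where "\<phi> = (+>\<^bsub>R\<^esub>) I"
  define K where "K = \<phi> ` Set.range pconst"
  define x :: "pmonom \<Rightarrow> 'k mpoly set" where "x m = \<phi> (Poly_Mapping.single m 1)" for m
  interpret R: cring R unfolding R_def by (rule cring_poly_ring)
  interpret I: ideal I R unfolding I_def R_def by (rule ideal_monomial_ideal[OF up])
  interpret \<phi>: ring_hom_ring R "R Quot I" \<phi>
    unfolding \<phi>_def by (rule I.rcos_ring_hom_ring)
  have \<phi>_eq_iff: "\<phi> p = \<phi> q \<longleftrightarrow> p - q \<in> I" if "p \<in> carrier R" "q \<in> carrier R" for p q
    using R.quotient_eq_iff_same_a_r_cos[OF I.ideal_axioms that] that
    by (simp add: \<phi>_def R_def)
  \<comment> \<open>The quotient is not the zero ring, so the image of the constants is a subfield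
    of it.\<close>
  have "\<phi> 1 \<noteq> \<phi> 0"
    using \<open>0 \<notin> M\<close> by (subst \<phi>_eq_iff) (auto simp: R_def I_def monomial_ideal_def)
  then have "\<one>\<^bsub>R Quot I\<^esub> \<noteq> \<zero>\<^bsub>R Quot I\<^esub>"
    using \<phi>.hom_one \<phi>.hom_zero by (simp add: R_def)
  then have K: "subfield K (R Quot I)"
    unfolding K_def using subfield_range_pconst[of V]
    by (intro \<phi>.img_is_subfield) (simp_all add: R_def)
  \<comment> \<open>This mirrors the recursion of \<open>Span\<close>, which adds a multiple of the
    head to an element of the span of the tail.\<close>
  have scale: "\<phi> (pconst k) \<otimes>\<^bsub>R Quot I\<^esub> x m \<oplus>\<^bsub>R Quot I\<^esub> \<phi> p = \<phi> (Poly_Mapping.single m k + p)"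
    if "Poly_Mapping.keys m \<subseteq> V" "p \<in> carrier R" for k m p
  proof -
    have carr: "pconst k \<in> carrier R" "Poly_Mapping.single m 1 \<in> carrier R"
      using that by (simp_all add: R_def pconst_def)
    have "\<phi> (Poly_Mapping.single m k + p) =
        \<phi> (pconst k \<otimes>\<^bsub>R\<^esub> Poly_Mapping.single m 1 \<oplus>\<^bsub>R\<^esub> p)"
      by (simp add: R_def pconst_def mult_single)
    also have "\<dots> = \<phi> (pconst k) \<otimes>\<^bsub>R Quot I\<^esub> x m \<oplus>\<^bsub>R Quot I\<^esub> \<phi> p"
      using carr that(2) R.m_closed[OF carr] by (simp only: \<phi>.hom_add \<phi>.hom_mult x_def)
    finally show ?thesis ..
  qed
  have span: "\<phi>.S.Span K (map x ms) = \<phi> ` {p. Poly_Mapping.keys p \<subseteq> set ms}"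
    if "\<And>m. m \<in> set ms \<Longrightarrow> Poly_Mapping.keys m \<subseteq> V" for ms
    using that
  proof (induction ms)
    case Nil
    have "\<phi> 0 = \<zero>\<^bsub>R Quot I\<^esub>" using \<phi>.hom_zero by (simp add: R_def)
    then show ?case by simp
  next
    case (Cons m ms)
    have IH: "\<phi>.S.Span K (map x ms) = \<phi> ` {p. Poly_Mapping.keys p \<subseteq> set ms}"
      using Cons by simp
    have carr: "p \<in> carrier R" if "Poly_Mapping.keys p \<subseteq> set (m # ms)" for p
      using that Cons.prems by (auto simp: R_def)
    have "u \<in> \<phi>.S.line_extension K (x m) (\<phi>.S.Span K (map x ms)) \<longleftrightarrow>
        u \<in> \<phi> ` {p. Poly_Mapping.keys p \<subseteq> set (m # ms)}" for u
    proof
      assume "u \<in> \<phi>.S.line_extension K (x m) (\<phi>.S.Span K (map x ms))"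
      then obtain k p where p: "Poly_Mapping.keys p \<subseteq> set ms"
        and u: "u = \<phi> (pconst k) \<otimes>\<^bsub>R Quot I\<^esub> x m \<oplus>\<^bsub>R Quot I\<^esub> \<phi> p"
        unfolding \<phi>.S.line_extension_mem_iff IH unfolding K_def by blast
      have "Poly_Mapping.keys (Poly_Mapping.single m k + p) \<subseteq> set (m # ms)"
        using p keys_add[of "Poly_Mapping.single m k" p] by (auto split: if_splits)
      moreover have "u = \<phi> (Poly_Mapping.single m k + p)"
        using Cons.prems p by (subst u, intro scale carr) auto
      ultimately show "u \<in> \<phi> ` {p. Poly_Mapping.keys p \<subseteq> set (m # ms)}" by blast
    next
      assume "u \<in> \<phi> ` {p. Poly_Mapping.keys p \<subseteq> set (m # ms)}"
      then obtain p where p: "Poly_Mapping.keys p \<subseteq> set (m # ms)" "u = \<phi> p" by blast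
      define q where "q = restrict_support (- {m}) p"
      have q: "Poly_Mapping.keys q \<subseteq> set ms"
        using p(1) by (auto simp: q_def keys_restrict_support)
      have "p = Poly_Mapping.single m (Poly_Mapping.lookup p m) + q"
        by (rule poly_mapping_eqI)
          (auto simp: q_def lookup_add lookup_restrict_support lookup_single when_def)
      then have "u = \<phi> (pconst (Poly_Mapping.lookup p m)) \<otimes>\<^bsub>R Quot I\<^esub> x m \<oplus>\<^bsub>R Quot I\<^esub> \<phi> q"
        using scale[of m q "Poly_Mapping.lookup p m"] Cons.prems carr[of q] q p(2) by auto
      then show "u \<in> \<phi>.S.line_extension K (x m) (\<phi>.S.Span K (map x ms))"
        unfolding \<phi>.S.line_extension_mem_iff IH unfolding K_def using q by blast
    qed
    then show ?case by auto
  qed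
  have independent: "\<phi>.S.independent K (map x ms)" if "distinct ms" "set ms \<subseteq> S" for ms
    using that
  proof (induction ms)
    case Nil
    then show ?case by simp
  next
    case (Cons m ms)
    have m: "Poly_Mapping.keys m \<subseteq> V" "m \<notin> M" "m \<notin> set ms"
      using Cons.prems by (auto simp: S_def)
    have ms: "Poly_Mapping.keys m' \<subseteq> V" if "m' \<in> set ms" for m'
      using Cons.prems that by (auto simp: S_def)
    have "x m \<notin> \<phi>.S.Span K (map x ms)"
    proof
      assume "x m \<in> \<phi>.S.Span K (map x ms)"
      moreover have "\<phi>.S.Span K (map x ms) = \<phi> ` {p. Poly_Mapping.keys p \<subseteq> set ms}"
        using ms by (rule span)
      ultimately obtain p where p: "Poly_Mapping.keys p \<subseteq> set ms" "x m = \<phi> p" by auto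
      then have "Poly_Mapping.single m 1 - p \<in> I"
        using m(1) ms unfolding x_def by (subst (asm) \<phi>_eq_iff) (auto simp: R_def)
      \<comment> \<open>The coefficient of \<open>m\<close> is 1 here, whereas elements of
        \<open>I\<close> are supported in \<open>M\<close>.\<close>
      moreover have "m \<in> Poly_Mapping.keys (Poly_Mapping.single m 1 - p)"
      proof -
        have "m \<notin> Poly_Mapping.keys p" using p(1) m(3) by blast
        then show ?thesis by (simp add: in_keys_iff lookup_minus)
      qed
      ultimately show False using m(2) by (auto simp: I_def monomial_ideal_def)
    qed
    moreover have "x m \<in> carrier (R Quot I)"
      using m(1) unfolding x_def by (intro \<phi>.hom_closed) (simp add: R_def)
    ultimately show ?case using Cons by (auto intro: \<phi>.S.independent.li_Cons)
  qed
  have component: "\<phi> ` {p \<in> carrier R. homogeneous d p} = \<phi> ` {p. Poly_Mapping.keys p \<subseteq> S}"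
  proof (intro subset_antisym subsetI)
    fix u assume "u \<in> \<phi> ` {p \<in> carrier R. homogeneous d p}"
    then obtain p where p: "p \<in> carrier R" "homogeneous d p" "u = \<phi> p" by blast
    \<comment> \<open>Dropping the terms in \<open>M\<close> does not change the residue
      class.\<close>
    define q where "q = restrict_support (- M) p"
    have "p - q \<in> I"
      using p(1) by (auto simp: I_def monomial_ideal_def R_def q_def in_keys_iff lookup_minus
          lookup_restrict_support split: if_splits)
    moreover have "Poly_Mapping.keys q \<subseteq> S" "q \<in> carrier R"
      using p by (auto simp: q_def keys_restrict_support S_def R_def homogeneous_def)
    ultimately have "u = \<phi> q" using p by (simp add: \<phi>_eq_iff)
    then show "u \<in> \<phi> ` {p. Poly_Mapping.keys p \<subseteq> S}"
      using \<open>Poly_Mapping.keys q \<subseteq> S\<close> by blast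
  next
    fix u assume "u \<in> \<phi> ` {p. Poly_Mapping.keys p \<subseteq> S}"
    then obtain p where p: "Poly_Mapping.keys p \<subseteq> S" "u = \<phi> p" by blast
    then have "p \<in> carrier R" "homogeneous d p"
      by (auto simp: S_def R_def homogeneous_def)
    then show "u \<in> \<phi> ` {p \<in> carrier R. homogeneous d p}"
      using p(2) by blast
  qed
  obtain ms where ms: "set ms = S" "distinct ms"
    using finite_distinct_list[OF fin] unfolding S_def[symmetric] by blast
  have "\<phi>.S.dimension (length (map x ms)) K (\<phi>.S.Span K (map x ms))"
    using independent[OF ms(2)] ms(1) by (intro \<phi>.S.dimension_independent) simp
  moreover have "length (map x ms) = card S"
    using distinct_card[OF ms(2)] ms(1) by simp
  moreover have "Poly_Mapping.keys m \<subseteq> V" if "m \<in> set ms" for m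
    using that ms(1) by (simp add: S_def)
  then have "\<phi>.S.Span K (map x ms) = \<phi> ` {p. Poly_Mapping.keys p \<subseteq> set ms}"
    by (rule span)
  ultimately have "\<phi>.S.dimension (card S) K (\<phi> ` {p \<in> carrier R. homogeneous d p})"
    by (simp only: ms(1) component)
  then have "\<phi>.S.dim K (\<phi> ` {p \<in> carrier R. homogeneous d p}) = card S"
    using \<phi>.S.dimI[OF K] by (simp add: over_def)
  then show ?thesis by (simp add: S_def K_def \<phi>_def)
qed

section \<open>Orbits under increasing maps\<close>

text \<open>This links the inductive embedding, suited to counting, with index maps, the form in
  which \<open>Inc\<close> acts. Positions are counted from 0.\<close>

lemma list_emb_iff_strict_mono:
  "list_emb P xs ys \<longleftrightarrow>
     (\<exists>f. strict_mono_on {..<length xs} f \<and>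
        (\<forall>i<length xs. f i < length ys \<and> P (xs ! i) (ys ! f i)))" (is "_ \<longleftrightarrow> (\<exists>f. ?emb xs ys f)")
proof
  assume "list_emb P xs ys"
  then show "\<exists>f. ?emb xs ys f"
  proof (induction rule: list_emb.induct)
    case (list_emb_Nil ys)
    then show ?case by simp
  next
    case (list_emb_Cons xs ys y)
    then obtain f where "?emb xs ys f" by blast
    then have "?emb xs (y # ys) (Suc \<circ> f)"
      by (auto simp: strict_mono_on_def)
    then show ?case by blast
  next
    case (list_emb_Cons2 x y xs ys)
    then obtain f where f: "?emb xs ys f" by blast
    \<comment> \<open>The new first letter goes to position 0 and all others move up by one.\<close>
    define g where "g i = (case i of 0 \<Rightarrow> 0 | Suc j \<Rightarrow> Suc (f j))" for i
    have "?emb (x # xs) (y # ys) g"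
      using f \<open>P x y\<close> by (auto simp: strict_mono_on_def g_def nth_Cons split: nat.splits)
    then show ?case by blast
  qed
next
  assume "\<exists>f. ?emb xs ys f"
  then obtain f where "?emb xs ys f" by blast
  then show "list_emb P xs ys"
  proof (induction ys arbitrary: xs f)
    case Nil
    then have "xs = []" by (cases xs) auto
    then show ?case by simp
  next
    case (Cons y ys)
    show ?case
    proof (cases xs)
      case Nil
      then show ?thesis by simp
    next
      case xs: (Cons x xs')
      have mono: "f i < f j" if "i < j" "j < length xs" for i j
        using Cons.prems that by (auto simp: strict_mono_on_def)
      have pos: "0 < f i" if "0 < i" "i < length xs" for i
        using mono[OF that] by simp
      \<comment> \<open>If \<open>f 0\<close> is 0, then \<open>y\<close> is matched with
        \<open>x\<close>; otherwise \<open>y\<close> is skipped. In both cases the remaining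
        positions move down by one.\<close>
      show ?thesis
      proof (cases "f 0")
        case 0
        define g where "g i = f (Suc i) - 1" for i
        have "?emb xs' ys g"
        proof (intro conjI strict_mono_onI allI impI)
          fix i j assume "i \<in> {..<length xs'}" "j \<in> {..<length xs'}" "i < j"
          then show "g i < g j"
            using mono[of "Suc i" "Suc j"] pos[of "Suc i"] by (simp add: g_def xs)
        next
          fix i assume i: "i < length xs'"
          then have "0 < f (Suc i)" using pos[of "Suc i"] by (simp add: xs)
          moreover have "f (Suc i) < length (y # ys)" "P (xs ! Suc i) ((y # ys) ! f (Suc i))"
            using Cons.prems i by (auto simp: xs)
          ultimately show "g i < length ys" "P (xs' ! i) (ys ! g i)"
            by (simp_all add: g_def xs nth_Cons')
        qed
        then have "list_emb P xs' ys" by (rule Cons.IH)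
        moreover have "P x y" using Cons.prems 0 by (auto simp: xs)
        ultimately show ?thesis by (auto simp: xs)
      next
        case (Suc k)
        have pos': "0 < f i" if "i < length xs" for i
          using pos[of i] that Suc by (cases i) auto
        define g where "g i = f i - 1" for i
        have "?emb xs ys g"
        proof (intro conjI strict_mono_onI allI impI)
          fix i j assume "i \<in> {..<length xs}" "j \<in> {..<length xs}" "i < j"
          then show "g i < g j"
            using mono[of i j] pos'[of i] by (simp add: g_def)
        next
          fix i assume i: "i < length xs"
          moreover have "f i < length (y # ys)" "P (xs ! i) ((y # ys) ! f i)"
            using Cons.prems i by auto
          ultimately show "g i < length ys" "P (xs ! i) (ys ! g i)"
            using pos'[of i] by (simp_all add: g_def nth_Cons')
        qed
        then have "list_emb P xs ys" by (rule Cons.IH)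
        then show ?thesis by auto
      qed
    qed
  qed
qed

lemma Inc_less: "\<pi> \<in> Inc \<Longrightarrow> 1 \<le> i \<Longrightarrow> i < j \<Longrightarrow> \<pi> i < \<pi> j"
proof (induction j)
  case (Suc j)
  then have "\<pi> j < \<pi> (Suc j)" by (simp add: Inc_def)
  then show ?case using Suc by (cases "i = j") auto
qed simp

lemma inj_on_Inc: "\<pi> \<in> Inc \<Longrightarrow> inj_on \<pi> {1..}"
  by (rule linorder_inj_onI) (auto dest: Inc_less)

lemma Inc_ge_1: "\<pi> \<in> Inc \<Longrightarrow> 1 \<le> i \<Longrightarrow> 1 \<le> \<pi> i"
  by (simp add: Inc_def)

lemma strict_mono_on_extend_Inc:
  assumes "strict_mono_on {..<l} f"
  obtains \<pi> where "\<pi> \<in> Inc" "\<And>j. j \<in> {1..l} \<Longrightarrow> \<pi> j = Suc (f (j - 1))"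
proof
  \<comment> \<open>Beyond \<open>l\<close> the map continues with slope one, above the last
    prescribed value.\<close>
  define \<pi> where "\<pi> j = (if j \<le> l then Suc (f (j - 1)) else Suc (f (l - 1)) + j)" for j
  show "\<pi> \<in> Inc"
  proof -
    have "\<pi> i < \<pi> (Suc i)" if "1 \<le> i" for i
      using that assms by (auto simp: \<pi>_def strict_mono_on_def not_less_eq_eq le_Suc_eq)
    moreover have "1 \<le> \<pi> i" for i by (simp add: \<pi>_def)
    ultimately show ?thesis by (simp add: Inc_def)
  qed
  show "\<pi> j = Suc (f (j - 1))" if "j \<in> {1..l}" for j
    using that by (simp add: \<pi>_def)
qed

text \<open>This is the exponent vector of \<pi> applied to the matrix monomial; \<open>id\<close>
  gives the matrix monomial itself.\<close>

definition orbit_monomial :: "nat \<Rightarrow> nat \<Rightarrow> (nat \<Rightarrow> nat \<Rightarrow> nat) \<Rightarrow> (nat \<Rightarrow> nat) \<Rightarrow> pmonom" where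
  "orbit_monomial c l a \<pi> = (\<Sum>(i, j)\<in>{1..c} \<times> {1..l}. Poly_Mapping.single (i, \<pi> j) (a i j))"

text \<open>Injectivity keeps columns from merging, so no two matrix entries add up at one
  variable.\<close>

lemma lookup_orbit_monomial:
  assumes "inj_on \<pi> {1..l}" "i \<in> {1..c}" "j \<in> {1..l}"
  shows "Poly_Mapping.lookup (orbit_monomial c l a \<pi>) (i, \<pi> j) = a i j"
proof -
  have "Poly_Mapping.lookup (orbit_monomial c l a \<pi>) (i, \<pi> j) =
      (\<Sum>v\<in>{1..c} \<times> {1..l}. if v = (i, j) then a i j else 0)"
    unfolding orbit_monomial_def lookup_sum
  proof (rule sum.cong[OF refl])
    fix v assume "v \<in> {1..c} \<times> {1..l}"
    then obtain i' j' where v: "v = (i', j')" "j' \<in> {1..l}" by blast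
    then have "\<pi> j' = \<pi> j \<longleftrightarrow> j' = j" using assms(1,3) by (simp add: inj_on_eq_iff)
    then show "Poly_Mapping.lookup (case v of (i, j) \<Rightarrow> Poly_Mapping.single (i, \<pi> j) (a i j)) (i, \<pi> j) =
        (if v = (i, j) then a i j else 0)"
      by (auto simp: v lookup_single when_def)
  qed
  also have "\<dots> = a i j" using assms by simp
  finally show ?thesis .
qed

lemma keys_orbit_monomial:
  "Poly_Mapping.keys (orbit_monomial c l a \<pi>) \<subseteq> (\<lambda>(i, j). (i, \<pi> j)) ` ({1..c} \<times> {1..l})"
proof
  fix v assume "v \<in> Poly_Mapping.keys (orbit_monomial c l a \<pi>)"
  then have "v \<in> (\<Union>x\<in>{1..c} \<times> {1..l}.
      Poly_Mapping.keys (case x of (i, j) \<Rightarrow> Poly_Mapping.single (i, \<pi> j) (a i j)))"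
    unfolding orbit_monomial_def by (rule subsetD[OF keys_sum])
  then obtain i j where "(i, j) \<in> {1..c} \<times> {1..l}"
    "v \<in> Poly_Mapping.keys (Poly_Mapping.single (i, \<pi> j) (a i j))" by fastforce
  then show "v \<in> (\<lambda>(i, j). (i, \<pi> j)) ` ({1..c} \<times> {1..l})"
    by (intro image_eqI[of _ _ "(i, j)"]) (auto split: if_splits)
qed

lemma ex_eq_orbit_monomial_add_iff:
  assumes "inj_on \<pi> {1..l}"
  shows "(\<exists>m'. m = orbit_monomial c l a \<pi> + m') \<longleftrightarrow>
    (\<forall>i\<in>{1..c}. \<forall>j\<in>{1..l}. a i j \<le> Poly_Mapping.lookup m (i, \<pi> j))"
proof
  assume "\<exists>m'. m = orbit_monomial c l a \<pi> + m'"
  then obtain m' where m: "m = orbit_monomial c l a \<pi> + m'" ..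
  show "\<forall>i\<in>{1..c}. \<forall>j\<in>{1..l}. a i j \<le> Poly_Mapping.lookup m (i, \<pi> j)"
    using lookup_orbit_monomial[OF assms] unfolding m lookup_add by (metis le_add1)
next
  assume le: "\<forall>i\<in>{1..c}. \<forall>j\<in>{1..l}. a i j \<le> Poly_Mapping.lookup m (i, \<pi> j)"
  have "Poly_Mapping.lookup (orbit_monomial c l a \<pi>) v \<le> Poly_Mapping.lookup m v" for v
  proof (cases "v \<in> Poly_Mapping.keys (orbit_monomial c l a \<pi>)")
    case True
    then obtain i j where "v = (i, \<pi> j)" "i \<in> {1..c}" "j \<in> {1..l}"
      by (auto dest!: subsetD[OF keys_orbit_monomial])
    then show ?thesis using lookup_orbit_monomial[OF assms] le by metis
  qed (simp add: in_keys_iff)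
  \<comment> \<open>Subtraction of exponents is truncated; the bound on all exponents makes it
    exact.\<close>
  then have "m = orbit_monomial c l a \<pi> + (m - orbit_monomial c l a \<pi>)"
    by (intro poly_mapping_eqI) (simp add: lookup_add lookup_minus)
  then show "\<exists>m'. m = orbit_monomial c l a \<pi> + m'" ..
qed

lemma pvar_power:
  "(pvar i j :: 'k::comm_ring_1 mpoly) ^ k = Poly_Mapping.single (Poly_Mapping.single (i, j) k) 1"
  by (induction k) (auto simp: pvar_def mult_single single_add[symmetric])

lemma prod_single_1:
  "(\<Prod>x\<in>A. Poly_Mapping.single (f x) (1 :: 'k::comm_ring_1)) =
    Poly_Mapping.single (\<Sum>x\<in>A. f x :: pmonom) 1"
  by (induction A rule: infinite_finite_induct) (auto simp: mult_single)

lemma matrix_monomial_eq: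
  "(matrix_monomial c l a :: 'k::comm_ring_1 mpoly) =
    Poly_Mapping.single (orbit_monomial c l a id) 1"
  by (simp add: matrix_monomial_def orbit_monomial_def pvar_power prod_single_1
      sum.cartesian_product)

lemma inc_act_matrix_monomial:
  "inc_act \<pi> (matrix_monomial c l a :: 'k::comm_ring_1 mpoly) =
    Poly_Mapping.single (orbit_monomial c l a \<pi>) 1"
proof -
  define M where "M = orbit_monomial c l a id"
  have lookup_M: "Poly_Mapping.lookup M (i, j) = a i j" if "i \<in> {1..c}" "j \<in> {1..l}" for i j
    using lookup_orbit_monomial[of id l i c j a] that by (simp add: M_def)
  have keys_M: "Poly_Mapping.keys M \<subseteq> {1..c} \<times> {1..l}"
    using keys_orbit_monomial[of c l a id] by (simp add: M_def)
  have "inc_act \<pi> (matrix_monomial c l a :: 'k mpoly) =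
      Poly_Mapping.single (\<Sum>(i, j)\<in>Poly_Mapping.keys M.
        Poly_Mapping.single (i, \<pi> j) (Poly_Mapping.lookup M (i, j))) 1"
    by (simp add: inc_act_def matrix_monomial_eq M_def[symmetric] pvar_power prod_single_1
        case_prod_unfold pconst_def)
  \<comment> \<open>The action visits nonzero exponents only; the other entries of the matrix
    contribute zero.\<close>
  also have "(\<Sum>(i, j)\<in>Poly_Mapping.keys M.
        Poly_Mapping.single (i, \<pi> j) (Poly_Mapping.lookup M (i, j))) = orbit_monomial c l a \<pi>"
    unfolding orbit_monomial_def
  proof (rule sum.mono_neutral_cong_left)
    fix v assume "v \<in> Poly_Mapping.keys M"
    then show "(case v of (i, j) \<Rightarrow> Poly_Mapping.single (i, \<pi> j) (Poly_Mapping.lookup M (i, j))) =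
        (case v of (i, j) \<Rightarrow> Poly_Mapping.single (i, \<pi> j) (a i j))"
      using keys_M lookup_M by (cases v) (auto simp del: in_keys_iff)
  next
    show "\<forall>v\<in>{1..c} \<times> {1..l} - Poly_Mapping.keys M.
        (case v of (i, j) \<Rightarrow> Poly_Mapping.single (i, \<pi> j) (a i j)) = 0"
      using lookup_M by (auto simp: in_keys_iff)
  qed (use keys_M in auto)
  finally show ?thesis .
qed

text \<open>By \<open>ex_eq_orbit_monomial_add_iff\<close> these are the exponent vectors of the
  monomials divisible by an element of the orbit.\<close>

definition orbit_multiples :: "nat \<Rightarrow> nat \<Rightarrow> (nat \<Rightarrow> nat \<Rightarrow> nat) \<Rightarrow> pmonom set" where
  "orbit_multiples c l a =
     {m. \<exists>\<pi>\<in>Inc. \<forall>i\<in>{1..c}. \<forall>j\<in>{1..l}. a i j \<le> Poly_Mapping.lookup m (i, \<pi> j)}"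

lemma orbit_multiples_add: "m \<in> orbit_multiples c l a \<Longrightarrow> m + m' \<in> orbit_multiples c l a"
  unfolding orbit_multiples_def by (auto simp: lookup_add intro: trans_le_add1)

lemma orbit_ideal_eq:
  "orbit_ideal c (matrix_monomial c l a :: 'k::comm_ring_1 mpoly) =
    monomial_ideal ({1..c} \<times> {1..}) (orbit_multiples c l a)"
proof -
  have inj: "inj_on \<pi> {1..l}" if "\<pi> \<in> Inc" for \<pi>
    using inj_on_Inc[OF that] by (rule inj_on_subset) auto
  have "orbit_ideal c (matrix_monomial c l a :: 'k mpoly) =
      Idl\<^bsub>KX c\<^esub> ((\<lambda>m. Poly_Mapping.single m 1) ` (orbit_monomial c l a ` Inc))"
    by (simp add: orbit_ideal_def inc_act_matrix_monomial image_image)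
  also have "\<dots> = monomial_ideal ({1..c} \<times> {1..}) {m + m' |m m'. m \<in> orbit_monomial c l a ` Inc}"
    unfolding KX_def
  proof (rule genideal_monomials)
    fix m assume "m \<in> orbit_monomial c l a ` Inc"
    then obtain \<pi> where "\<pi> \<in> Inc" "m = orbit_monomial c l a \<pi>" by blast
    then show "Poly_Mapping.keys m \<subseteq> {1..c} \<times> {1..}"
      using keys_orbit_monomial[of c l a \<pi>] Inc_ge_1[of \<pi>] by fastforce
  qed
  also have "{m + m' |m m'. m \<in> orbit_monomial c l a ` Inc} =
      {m. \<exists>\<pi>\<in>Inc. \<exists>m'. m = orbit_monomial c l a \<pi> + m'}"
    by blast
  also have "\<dots> = orbit_multiples c l a"
    unfolding orbit_multiples_def
    by (intro Collect_cong bex_cong refl ex_eq_orbit_monomial_add_iff inj)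
  finally show ?thesis .
qed

section \<open>Monomials as words of columns\<close>

definition columns :: "nat \<Rightarrow> nat \<Rightarrow> (nat \<Rightarrow> nat \<Rightarrow> nat) \<Rightarrow> nat list list" where
  "columns c n a = map (\<lambda>j. map (\<lambda>i. a i j) [1..<Suc c]) [1..<Suc n]"

lemma length_columns [simp]: "length (columns c n a) = n"
  by (simp add: columns_def)

lemma set_columns: "set (columns c n a) \<subseteq> {v. length v = c}"
  by (auto simp: columns_def)

lemma nth_columns: "j < n \<Longrightarrow> columns c n a ! j = map (\<lambda>i. a i (Suc j)) [1..<Suc c]"
  by (simp add: columns_def del: upt_Suc)

lemma sum_list_column: "sum_list (map f [1..<Suc n]) = (\<Sum>i=1..n. f i :: nat)"
  by (simp add: interv_sum_list_conv_sum_set_nat atLeastLessThanSuc_atLeastAtMost del: upt_Suc)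

lemma total_columns: "total (columns c n a) = (\<Sum>j=1..n. \<Sum>i=1..c. a i j)"
  unfolding columns_def map_map o_def sum_list_column ..

lemma list_all2_le_map_iff:
  "list_all2 (\<le>) (map f [1..<Suc c]) (map g [1..<Suc c]) \<longleftrightarrow> (\<forall>i\<in>{1..c}. f i \<le> g i)" for f g :: "nat \<Rightarrow> nat"
  by (auto simp: list_all2_map1 list_all2_map2 list_all2_same simp del: upt_Suc)

definition exponent :: "pmonom \<Rightarrow> nat \<Rightarrow> nat \<Rightarrow> nat" where
  "exponent m i j = Poly_Mapping.lookup m (i, j)"

text \<open>A zero last column could be matched by a column beyond the \<open>n\<close>-th one.\<close>

lemma orbit_multiples_iff_list_emb:
  assumes "1 \<le> l" "i0 \<in> {1..c}" "a i0 l \<noteq> 0" and keys: "Poly_Mapping.keys m \<subseteq> {1..c} \<times> {1..n}"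
  shows "m \<in> orbit_multiples c l a \<longleftrightarrow>
    list_emb (list_all2 (\<le>)) (columns c l a) (columns c n (exponent m))"
proof
  assume "m \<in> orbit_multiples c l a"
  then obtain \<pi> where \<pi>: "\<pi> \<in> Inc"
    and le: "\<And>i j. i \<in> {1..c} \<Longrightarrow> j \<in> {1..l} \<Longrightarrow> a i j \<le> exponent m i (\<pi> j)"
    by (auto simp: orbit_multiples_def exponent_def)
  \<comment> \<open>The last pattern column is nonzero, so its image is among the first
    \<open>n\<close> columns, and monotonicity places the earlier images there too.\<close>
  have "exponent m i0 (\<pi> l) \<noteq> 0" using le[of i0 l] assms by auto
  then have "(i0, \<pi> l) \<in> Poly_Mapping.keys m" by (simp add: exponent_def in_keys_iff)
  then have "\<pi> l \<le> n" using keys by auto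
  define f where "f i = \<pi> (Suc i) - 1" for i
  have Suc_f: "Suc (f i) = \<pi> (Suc i)" for i
    using Inc_ge_1[OF \<pi>, of "Suc i"] by (simp add: f_def)
  have "f i < f j" if "i < j" for i j
    using Inc_less[OF \<pi>, of "Suc i" "Suc j"] that Suc_f[of i] Suc_f[of j] by simp
  then have "strict_mono_on {..<l} f" by (auto simp: strict_mono_on_def)
  moreover have f_less: "f j < n" if "j < l" for j
  proof -
    have "\<pi> (Suc j) \<le> \<pi> l"
      using Inc_less[OF \<pi>, of "Suc j" l] that by (cases "Suc j = l") auto
    then show ?thesis using \<open>\<pi> l \<le> n\<close> Suc_f[of j] by simp
  qed
  moreover have "list_all2 (\<le>) (columns c l a ! j) (columns c n (exponent m) ! f j)"
    if "j < l" for j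
    unfolding nth_columns[OF that] nth_columns[OF f_less[OF that]] list_all2_le_map_iff Suc_f
    using le that by simp
  ultimately show "list_emb (list_all2 (\<le>)) (columns c l a) (columns c n (exponent m))"
    unfolding list_emb_iff_strict_mono by auto
next
  assume "list_emb (list_all2 (\<le>)) (columns c l a) (columns c n (exponent m))"
  then obtain f where mono: "strict_mono_on {..<l} f"
    and f: "\<And>j. j < l \<Longrightarrow> f j < n"
      "\<And>j. j < l \<Longrightarrow> list_all2 (\<le>) (columns c l a ! j) (columns c n (exponent m) ! f j)"
    unfolding list_emb_iff_strict_mono by auto
  obtain \<pi> where \<pi>: "\<pi> \<in> Inc" "\<And>j. j \<in> {1..l} \<Longrightarrow> \<pi> j = Suc (f (j - 1))"
    using strict_mono_on_extend_Inc[OF mono] by blast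
  have "a i j \<le> exponent m i (\<pi> j)" if "i \<in> {1..c}" "j \<in> {1..l}" for i j
  proof -
    have "j - 1 < l" using that by auto
    then show ?thesis
      using f(2)[of "j - 1"] that \<pi>(2)
      unfolding nth_columns[OF f(1)[OF \<open>j - 1 < l\<close>]] nth_columns[OF \<open>j - 1 < l\<close>] list_all2_le_map_iff
      by auto
  qed
  then show "m \<in> orbit_multiples c l a"
    using \<pi>(1) unfolding orbit_multiples_def exponent_def by blast
qed

lemma pmonom_deg_eq_sum:
  assumes "Poly_Mapping.keys m \<subseteq> A" "finite A"
  shows "pmonom_deg m = (\<Sum>v\<in>A. Poly_Mapping.lookup m v)"
  unfolding pmonom_deg_def using assms by (intro sum.mono_neutral_left) (auto simp: in_keys_iff)

lemma bij_betw_columns: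
  "bij_betw (\<lambda>m. columns c n (exponent m)) {m. Poly_Mapping.keys m \<subseteq> {1..c} \<times> {1..n}}
    {vs. length vs = n \<and> set vs \<subseteq> {v. length v = c}}"
proof (rule bij_betw_imageI)
  show "inj_on (\<lambda>m. columns c n (exponent m)) {m. Poly_Mapping.keys m \<subseteq> {1..c} \<times> {1..n}}"
  proof (rule inj_onI, rule poly_mapping_eqI)
    fix m m' v
    assume m: "m \<in> {m. Poly_Mapping.keys m \<subseteq> {1..c} \<times> {1..n}}"
      "m' \<in> {m. Poly_Mapping.keys m \<subseteq> {1..c} \<times> {1..n}}"
      and eq: "columns c n (exponent m) = columns c n (exponent m')"
    show "Poly_Mapping.lookup m v = Poly_Mapping.lookup m' v"
    proof (cases "v \<in> {1..c} \<times> {1..n}")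
      case True
      then show ?thesis
        using eq by (cases v) (auto simp: columns_def exponent_def simp del: upt_Suc)
    next
      case False
      then have "v \<notin> Poly_Mapping.keys m" "v \<notin> Poly_Mapping.keys m'" using m by auto
      then show ?thesis by (simp add: in_keys_iff)
    qed
  qed
  show "(\<lambda>m. columns c n (exponent m)) ` {m. Poly_Mapping.keys m \<subseteq> {1..c} \<times> {1..n}} =
    {vs. length vs = n \<and> set vs \<subseteq> {v. length v = c}}"
  proof (intro subset_antisym subsetI)
    fix vs :: "nat list list"
    assume "vs \<in> {vs. length vs = n \<and> set vs \<subseteq> {v. length v = c}}"
    then have vs: "length vs = n" "\<And>j. j < n \<Longrightarrow> length (vs ! j) = c"
      by (auto simp: subset_iff)
    \<comment> \<open>With \<open>id\<close>, \<open>orbit_monomial\<close> builds a monomial with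
      prescribed exponents; subtracting 1 turns indices into list positions.\<close>
    define m where "m = orbit_monomial c n (\<lambda>i j. vs ! (j - 1) ! (i - 1)) id"
    have "columns c n (exponent m) = vs"
    proof (rule nth_equalityI)
      fix j assume "j < length (columns c n (exponent m))"
      then have j: "j < n" by simp
      show "columns c n (exponent m) ! j = vs ! j"
      proof (rule nth_equalityI)
        fix i assume "i < length (columns c n (exponent m) ! j)"
        then have i: "i < c" by (simp add: nth_columns[OF j] del: upt_Suc)
        then show "columns c n (exponent m) ! j ! i = vs ! j ! i"
          using lookup_orbit_monomial[of id n "Suc i" c "Suc j"] j
          by (simp add: nth_columns[OF j] exponent_def m_def del: upt_Suc)
      qed (simp add: nth_columns[OF j] vs(2)[OF j])
    qed (simp add: vs(1))
    moreover have "Poly_Mapping.keys m \<subseteq> {1..c} \<times> {1..n}"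
      using keys_orbit_monomial[of c n _ id] by (simp add: m_def)
    ultimately show "vs \<in> (\<lambda>m. columns c n (exponent m)) ` {m. Poly_Mapping.keys m \<subseteq> {1..c} \<times> {1..n}}"
      by blast
  qed (use set_columns in auto)
qed

lemma total_columns_exponent:
  assumes "Poly_Mapping.keys m \<subseteq> {1..c} \<times> {1..n}"
  shows "total (columns c n (exponent m)) = pmonom_deg m"
proof -
  have "total (columns c n (exponent m)) = (\<Sum>i=1..c. \<Sum>j=1..n. Poly_Mapping.lookup m (i, j))"
    unfolding total_columns exponent_def by (rule sum.swap)
  also have "\<dots> = (\<Sum>v\<in>{1..c} \<times> {1..n}. Poly_Mapping.lookup m v)"
    by (simp add: sum.cartesian_product)
  finally show ?thesis using pmonom_deg_eq_sum[OF assms] by simp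
qed

text \<open>Each dimension is a number of monomials outside the ideal, and \<open>columns\<close>
  maps these bijectively to the avoiding words, turning degree into total weight.\<close>

lemma equivariant_hilbert_series_orbit_ideal:
  assumes "1 \<le> l" "i0 \<in> {1..c}" "a i0 l \<noteq> 0"
  shows "equivariant_hilbert_series c (orbit_ideal c (matrix_monomial c l a :: 'k::field mpoly)) =
    avoiding_series c (columns c l a)"
proof -
  define I where "I = orbit_ideal c (matrix_monomial c l a :: 'k mpoly)"
  have "int (quot_component_dim c I n d) = weight_series (avoiding c (columns c l a) n) total $ d"
    for n d
  proof -
    define S where "S = {m. Poly_Mapping.keys m \<subseteq> {1..c} \<times> {1..n} \<and> pmonom_deg m = d \<and>
      m \<notin> orbit_multiples c l a}"
    have trunc: "trunc_ideal c I n = monomial_ideal ({1..c} \<times> {1..n}) (orbit_multiples c l a)"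
      unfolding I_def orbit_ideal_eq trunc_ideal_def KXn_def
      by (intro monomial_ideal_Int_carrier) auto
    have bij: "bij_betw (\<lambda>m. columns c n (exponent m)) S
        {vs \<in> avoiding c (columns c l a) n. total vs = d}"
    proof -
      have "(\<lambda>m. columns c n (exponent m)) ` S = {vs \<in> avoiding c (columns c l a) n. total vs = d}"
      proof (intro subset_antisym subsetI)
        fix vs assume vs: "vs \<in> {vs \<in> avoiding c (columns c l a) n. total vs = d}"
        then have "vs \<in> (\<lambda>m. columns c n (exponent m)) ` {m. Poly_Mapping.keys m \<subseteq> {1..c} \<times> {1..n}}"
          using bij_betw_columns[of c n] by (auto simp: bij_betw_def avoiding_def)
        then show "vs \<in> (\<lambda>m. columns c n (exponent m)) ` S"
          using vs by (auto simp: S_def orbit_multiples_iff_list_emb[of l i0 c a, OF assms] avoiding_def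
              total_columns_exponent)
      qed (use set_columns in \<open>auto simp: S_def orbit_multiples_iff_list_emb[of l i0 c a, OF assms]
            avoiding_def total_columns_exponent\<close>)
      then show ?thesis
        using bij_betw_columns[of c n] by (auto intro: bij_betw_subset simp: S_def)
    qed
    have "finite {vs \<in> avoiding c (columns c l a) n. total vs = d}"
      using fin_fibres_avoiding[OF set_columns] unfolding fin_fibres_def by blast
    then have "finite S" using bij bij_betw_finite by blast
    \<comment> \<open>The nonzero entry \<open>a i0 l\<close> is not bounded by a zero
      exponent.\<close>
    moreover have "0 \<notin> orbit_multiples c l a"
      using assms by (fastforce simp: orbit_multiples_def)
    ultimately have "quot_component_dim c I n d = card S"
      unfolding quot_component_dim_def quot_component_def trunc_quot_def residue_class_def trunc KXn_def
      unfolding S_def by (intro dim_quot_monomial_ideal orbit_multiples_add)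
    then show ?thesis
      using bij_betw_same_card[OF bij] by (simp add: weight_series_nth)
  qed
  then show ?thesis
    by (simp add: equivariant_hilbert_series_def avoiding_series_def I_def fps_eq_iff)
qed

section \<open>The series for a matrix with prescribed nonzero columns\<close>

theorem theorem3p3:
  fixes c r :: nat
    and \<mu> :: "nat \<Rightarrow> nat"
    and a :: "nat \<Rightarrow> nat \<Rightarrow> nat"
    and b :: "nat \<Rightarrow> nat"
    and I :: "'k::field mpoly set"
  assumes "1 \<le> c"
    and "1 \<le> r"
    and "strict_mono_on {1..r} \<mu>"
    and "{j \<in> {1..\<mu> r}. \<exists>i\<in>{1..c}. a i j \<noteq> 0} = \<mu> ` {1..r}"
    and "(\<Sum>i=1..c. \<Sum>j=1..\<mu> r. a i j) > 0"
    and "\<forall>j\<in>{1..r}. b j = (\<Sum>i=1..c. a i (\<mu> j))"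
    and "I = orbit_ideal c (matrix_monomial c (\<mu> r) a)"
  shows "(\<exists>!g. hilbert_num_eq r c b \<mu> g) \<and>
         (\<forall>g. hilbert_num_eq r c b \<mu> g \<longrightarrow>
            is_fps_quotient (equivariant_hilbert_series c I)
              (hilbert_num r c \<mu> g) (hilbert_den r c b \<mu>) \<and>
            coprime (hilbert_num r c \<mu> g) (hilbert_den r c b \<mu>)) \<and>
         (hilbert_exp r c \<mu> < 0 \<longleftrightarrow> r < c \<and> \<mu> r = r)"
proof -
  define l where "l = \<mu> r"
  define B where "B j = (\<Sum>i=1..c. a i j)" for j
  have inj: "inj_on \<mu> {1..r}" using assms(3) by (rule strict_mono_on_imp_inj_on)
  have b: "b j = B (\<mu> j)" if "j \<in> {1..r}" for j
    using assms(6) that by (simp add: B_def)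
  have support: "\<mu> ` {1..r} \<subseteq> {1..l}" and nonzero: "\<And>j. j \<in> \<mu> ` {1..r} \<Longrightarrow> \<exists>i\<in>{1..c}. a i j \<noteq> 0"
    unfolding assms(4)[symmetric] by (auto simp: l_def)
  have B_zero: "B j = 0" if "j \<in> {1..l} - \<mu> ` {1..r}" for j
    using that unfolding assms(4)[symmetric] by (auto simp: B_def l_def)
  have card_im: "card (\<mu> ` {1..r}) = r" using card_image[OF inj] by simp
  have "r \<le> l" using card_mono[OF _ support] unfolding card_im by simp
  have b_pos: "0 < b j" if j: "j \<in> {1..r}" for j
  proof -
    obtain i where "i \<in> {1..c}" "a i (\<mu> j) \<noteq> 0" using nonzero[of "\<mu> j"] j by blast
    then have "B (\<mu> j) \<noteq> 0" by (auto simp: B_def)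
    then show ?thesis using b[OF j] by simp
  qed
  \<comment> \<open>Column \<open>l\<close> is \<open>\<mu> r\<close> with \<open>r\<close> in
    \<open>{1..r}\<close>, hence nonzero, as the embedding criterion requires.\<close>
  obtain i0 where i0: "i0 \<in> {1..c}" "a i0 l \<noteq> 0"
    using nonzero[of l] assms(2) by (auto simp: l_def)
  define u :: "int fps fps" where "u = fps_const ((1 - fps_X) ^ c)"
  define t :: "int fps fps" where "t = fps_const fps_X"
  define H where "H = equivariant_hilbert_series c I"
  have H: "H = avoiding_series c (columns c l a)"
    using equivariant_hilbert_series_orbit_ideal[of l i0 c a] i0 \<open>r \<le> l\<close> assms(2,7)
    by (simp add: H_def l_def)
  have "(\<Prod>x\<leftarrow>columns c l a. u - fps_X + fps_X * t ^ sum_list x) =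
      (\<Prod>j\<leftarrow>[1..<Suc l]. u - fps_X + fps_X * t ^ B j)"
    unfolding columns_def map_map o_def sum_list_column B_def ..
  also have "\<dots> = (\<Prod>j=1..l. u - fps_X + fps_X * t ^ B j)"
    by (simp add: prod.distinct_set_conv_list atLeastLessThanSuc_atLeastAtMost
        flip: prod.distinct_set_conv_list del: upt_Suc)
  \<comment> \<open>A zero column has weight 0, so its factor collapses to \<open>u\<close>; there
    are \<open>l - r\<close> such columns.\<close>
  also have "\<dots> = (\<Prod>j\<in>{1..l} - \<mu> ` {1..r}. u - fps_X + fps_X * t ^ B j) *
      (\<Prod>j\<in>\<mu> ` {1..r}. u - fps_X + fps_X * t ^ B j)"
    using support by (intro prod.subset_diff) auto
  also have "(\<Prod>j\<in>{1..l} - \<mu> ` {1..r}. u - fps_X + fps_X * t ^ B j) = u ^ (l - r)"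
    using card_Diff_subset[OF _ support] unfolding card_im by (simp add: B_zero)
  also have "(\<Prod>j\<in>\<mu> ` {1..r}. u - fps_X + fps_X * t ^ B j) =
      (\<Prod>j=1..r. u - fps_X + fps_X * t ^ b j)"
    by (subst prod.reindex[OF inj]) (simp add: b)
  finally have prod: "(\<Prod>x\<leftarrow>columns c l a. u - fps_X + fps_X * t ^ sum_list x) =
      u ^ (l - r) * (\<Prod>j=1..r. u - fps_X + fps_X * t ^ b j)" .
  have "total (columns c l a) = (\<Sum>j=1..l. B j)"
    by (simp only: total_columns B_def)
  also have "\<dots> = (\<Sum>j\<in>\<mu> ` {1..r}. B j)"
    using support B_zero by (intro sum.mono_neutral_right) auto
  also have "\<dots> = (\<Sum>j=1..r. b j)"
    by (subst sum.reindex[OF inj]) (simp add: b)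
  finally have total: "total (columns c l a) = (\<Sum>j=1..r. b j)" .
  have "(u ^ (l - r) * (\<Prod>j=1..r. u - fps_X + fps_X * t ^ b j)) * (u - fps_X) * H =
      u * (u ^ (l - r) * (\<Prod>j=1..r. u - fps_X + fps_X * t ^ b j) -
        fps_X ^ l * t ^ (\<Sum>j=1..r. b j))"
    using avoiding_series_eq[OF set_columns, of c l a]
    unfolding u_def[symmetric] t_def[symmetric] prod total length_columns H[symmetric] .
  then have "is_fps_quotient H (hilbert_num r c \<mu> g) (hilbert_den r c b \<mu>)"
    if "hilbert_num_eq r c b \<mu> g" for g
    using assms(1) \<open>r \<le> l\<close> b_pos that
    unfolding u_def t_def l_def by (intro is_fps_quotient_hilbert)
  moreover have "coprime (hilbert_num r c \<mu> g) (hilbert_den r c b \<mu>)"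
    if "hilbert_num_eq r c b \<mu> g" for g
    using assms(1,2) b_pos that by (intro coprime_hilbert_num_den)
  ultimately show ?thesis
    using ex1_hilbert_num_eq[of r \<mu> c b] hilbert_exp_neg_iff[of r \<mu> c] assms(2) \<open>r \<le> l\<close>
    unfolding l_def H_def by blast
qed

end
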